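(* For every $n\in\mathbb{N}$ let $X_n$ be a random vector in $\mathbb{R}^n$ with $\mathbb{E}(X_n)=0$ and $\mathbb{E}(X_n\otimes X_n)=I_n$, and let $(m_n)_{n\in\mathbb{N}}$ be a sequence in $\mathbb{N}$ with $$0<\liminf_{n\to\infty}\frac{n}{m_n}\le\limsup_{n\to\infty}\frac{n}{m_n}=:\overline{\rho}<\infty .$$ For every $n$ let $X_n^{(1)},\ldots,X_n^{(m_n)}$ be i.i.d. copies of $X_n$ and let $A_n:=\sum_{k=1}^{m_n}X_n^{(k)}\otimes X_n^{(k)}$. Assume that $\overline{\rho}<1$ and that the following two conditions hold. (a) $\displaystyle\lim_{M\to\infty}\ \sup_{n\in\mathbb{N},\,y\in S^{n-1}}\mathbb{E}\bigl(\langle X_n,y\rangle^2\mathbf{1}_{\{\langle X_n,y\rangle^2\ge M\}}\bigr)=0.$ (b) There exist functions $f:\mathbb{N}\to[0,1]$ and $g:\mathbb{N}\to\mathbb{R}_+$ with $f(r)\to0$ and $g(r)\to0$ as $r\to\infty$ such that for every $n\in\mathbb{N}$ and every orthogonal projection $P:\mathbb{R}^n\to\mathbb{R}^n$ with $P\ne0$, $$\mathbb{P}\bigl(\|PX_n\|^2-\operatorname{rank}P\ge f(\operatorname{rank}P)\operatorname{rank}P\bigr)\le g(\operatorname{rank}P).$$ Then $$\liminf_{n\to\infty}\frac{\mathbb{E}(\lambda_{\min}(A_n))}{(\sqrt{m_n}-\sqrt{n})^2}\ge1.$$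
   Context: $\mathbb{N}=\{1,2,\ldots\}$, $\mathbb{R}_+=[0,\infty)$. $\|\cdot\|$ is the Euclidean norm, $S^{n-1}=\{y\in\mathbb{R}^n:\|y\|=1\}$, $x\otimes x=xx^\top$, $I_n$ is the $n\times n$ identity matrix, and $\lambda_{\min}$ denotes the smallest eigenvalue of a symmetric matrix. Since $\overline{\rho}<1$, one has $m_n>n$ for all large $n$, so the quotient is defined for all large $n$. *)

theory Defs
  imports
    "HOL-Probability.Probability"
    "Jordan_Normal_Form.Spectral_Radius"
    "Jordan_Normal_Form.DL_Rank"
begin

unbundle no vec_syntax and no inner_syntax

text \<open>
  Vectors in \<open>\<real>\<^sup>n\<close> and \<open>n \<times> n\<close> matrices are elements of
  \<^term>\<open>carrier_vec n\<close> and \<^term>\<open>carrier_mat n n\<close>, with coordinates indexed by \<open>0, \<dots>, n - 1\<close>.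
  The Borel sigma-algebra on \<^term>\<open>carrier_vec n\<close> is transported from the product
  sigma-algebra along the coordinate bijection.
\<close>

definition borel_vec :: "nat \<Rightarrow> real Matrix.vec measure" where
  "borel_vec n = vimage_algebra (carrier_vec n)
     (\<lambda>v. \<lambda>i\<in>{..<n}. v $ i) (\<Pi>\<^sub>M i\<in>{..<n}. borel)"

abbreviation random_vector :: "'a measure \<Rightarrow> nat \<Rightarrow> ('a \<Rightarrow> real Matrix.vec) \<Rightarrow> bool" where
  "random_vector M n X \<equiv> X \<in> measurable M (borel_vec n)"

definition has_vec_expectation ::
    "'a measure \<Rightarrow> ('a \<Rightarrow> real Matrix.vec) \<Rightarrow> real Matrix.vec \<Rightarrow> bool" where
  "has_vec_expectation M X v \<longleftrightarrow>
     (\<forall>i<dim_vec v. has_bochner_integral M (\<lambda>\<omega>. X \<omega> $ i) (v $ i))"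

definition has_mat_expectation ::
    "'a measure \<Rightarrow> ('a \<Rightarrow> real Matrix.mat) \<Rightarrow> real Matrix.mat \<Rightarrow> bool" where
  "has_mat_expectation M Z B \<longleftrightarrow>
     (\<forall>i<dim_row B. \<forall>j<dim_col B. has_bochner_integral M (\<lambda>\<omega>. Z \<omega> $$ (i, j)) (B $$ (i, j)))"

definition outer_prod :: "real Matrix.vec \<Rightarrow> real Matrix.vec \<Rightarrow> real Matrix.mat" where
  "outer_prod x y = Matrix.mat (dim_vec x) (dim_vec y) (\<lambda>(i, j). x $ i * y $ j)"

definition iid_copies ::
    "'b measure \<Rightarrow> nat set \<Rightarrow> (nat \<Rightarrow> 'b \<Rightarrow> real Matrix.vec)
     \<Rightarrow> nat \<Rightarrow> 'a measure \<Rightarrow> ('a \<Rightarrow> real Matrix.vec) \<Rightarrow> bool" where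
  "iid_copies N I Y n M X \<longleftrightarrow>
     prob_space.indep_vars N (\<lambda>_. borel_vec n) Y I \<and>
     (\<forall>k\<in>I. distr N (borel_vec n) (Y k) = distr M (borel_vec n) X)"

text \<open>The matrix \<open>x\<^sub>1 \<otimes> x\<^sub>1 + \<dots> + x\<^sub>m \<otimes> x\<^sub>m\<close>, summed entrywise
  because the type of matrices of all sizes has no zero.\<close>

definition sum_outer_prod :: "nat \<Rightarrow> nat \<Rightarrow> (nat \<Rightarrow> real Matrix.vec) \<Rightarrow> real Matrix.mat" where
  "sum_outer_prod n m x =
     Matrix.mat n n (\<lambda>(i, j). \<Sum>k\<in>{1..m}. outer_prod (x k) (x k) $$ (i, j))"

definition lambda_min :: "real Matrix.mat \<Rightarrow> real" where
  "lambda_min B = Min (spectrum B)"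

definition euclid_norm :: "real Matrix.vec \<Rightarrow> real" where
  "euclid_norm v = sqrt (v \<bullet> v)"

definition unit_sphere :: "nat \<Rightarrow> real Matrix.vec set" where
  "unit_sphere n = {y \<in> carrier_vec n. euclid_norm y = 1}"

definition orthogonal_projection :: "nat \<Rightarrow> real Matrix.mat \<Rightarrow> bool" where
  "orthogonal_projection n P \<longleftrightarrow>
     P \<in> carrier_mat n n \<and> P * P = P \<and> transpose_mat P = P"

end

theory Submission
  imports Defs
begin

text \<open>
  The argument is the barrier method of Batson, Spielman and Srivastava. For a symmetric matrix \<open>A\<close> and
  \<open>u < \<lambda>\<^sub>m\<^sub>i\<^sub>n(A)\<close> let \<open>\<Phi>(A, u) = tr (A - u)\<^sup>-\<^sup>1\<close>. Adding \<open>x \<otimes> x\<close> lowers \<open>\<Phi>\<close> by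
  \<open>x\<^sup>T B\<^sup>2 x / (1 + x\<^sup>T B x)\<close> with \<open>B = (A - u)\<^sup>-\<^sup>1\<close>. If \<open>\<parallel>B\<parallel>\<close> is small, then condition (b), applied to the
  spectral projections of \<open>B\<close>, gives \<open>x\<^sup>T B x \<le> tr B + o(1 + tr B)\<close> with high probability, and by (a) the
  expected loss is at least \<open>(1 - o(1)) tr B\<^sup>2 / (1 + tr B)\<close>, which allows \<open>u\<close> to advance by
  \<open>(1 - o(1)) / (1 + \<Phi>)\<close> without increasing the expected potential. If \<open>\<parallel>B\<parallel>\<close> is not small, \<open>u\<close> rests and
  the expected potential drops by an amount comparable to the skipped advance; as the potential is
  nonnegative, resting costs only \<open>O(1)\<close> in total. Starting from \<open>A = 0\<close>,
  \<open>u = - n / \<phi>\<close> with \<open>\<phi> = \<surd>\<rho> / (1 - \<surd>\<rho>)\<close> and \<open>\<rho> = n / m\<close>, the barrier ends at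
  \<open>(1 - o(1)) m / (1 + \<phi>) - n / \<phi> - O(1)\<close>, and \<open>m / (1 + \<phi>) - n / \<phi> = (\<surd>m - \<surd>n)\<^sup>2\<close>.
\<close>

section \<open>The spectral theorem for real symmetric matrices\<close>

text \<open>Vectors are functions on \<nat> of which only the coordinates below \<open>n\<close>
  count. The dimension is thus an ordinary term, and the product topology on functions is at hand
  for compactness and for countable dense sets.\<close>

definition ip :: "nat \<Rightarrow> (nat \<Rightarrow> real) \<Rightarrow> (nat \<Rightarrow> real) \<Rightarrow> real" where
  "ip n x y = (\<Sum>i<n. x i * y i)"

definition mv :: "nat \<Rightarrow> (nat \<Rightarrow> nat \<Rightarrow> real) \<Rightarrow> (nat \<Rightarrow> real) \<Rightarrow> nat \<Rightarrow> real" where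
  "mv n A x i = (\<Sum>j<n. A i j * x j)"

definition orthonormal :: "nat \<Rightarrow> nat \<Rightarrow> (nat \<Rightarrow> nat \<Rightarrow> real) \<Rightarrow> bool" where
  "orthonormal n k e \<longleftrightarrow> (\<forall>i<k. \<forall>j<k. ip n (e i) (e j) = (if i = j then 1 else 0))"

definition symm :: "nat \<Rightarrow> (nat \<Rightarrow> nat \<Rightarrow> real) \<Rightarrow> bool" where
  "symm n A \<longleftrightarrow> (\<forall>i<n. \<forall>j<n. A i j = A j i)"

lemma ip_commute: "ip n x y = ip n y x"
  by (simp add: ip_def mult.commute)

lemma ip_add_left: "ip n (\<lambda>i. x i + y i) z = ip n x z + ip n y z"
  by (simp add: ip_def distrib_right sum.distrib)

lemma ip_diff_left: "ip n (\<lambda>i. x i - y i) z = ip n x z - ip n y z"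
  by (simp add: ip_def left_diff_distrib sum_subtractf)

lemma ip_scale_left: "ip n (\<lambda>i. c * x i) z = c * ip n x z"
  by (simp add: ip_def sum_distrib_left mult.assoc)

lemma ip_add_right: "ip n z (\<lambda>i. x i + y i) = ip n z x + ip n z y"
  by (simp add: ip_def distrib_left sum.distrib)

lemma ip_diff_right: "ip n z (\<lambda>i. x i - y i) = ip n z x - ip n z y"
  by (simp add: ip_def right_diff_distrib sum_subtractf)

lemma ip_scale_right: "ip n z (\<lambda>i. c * x i) = c * ip n z x"
  by (simp add: ip_def sum_distrib_left mult_ac)

lemma ip_sum_left: "ip n (\<lambda>i. \<Sum>l\<in>S. c l * e l i) y = (\<Sum>l\<in>S. c l * ip n (e l) y)"
  unfolding ip_def sum_distrib_right sum_distrib_left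
  by (subst sum.swap) (simp add: mult.assoc)

lemma ip_sum_right: "ip n y (\<lambda>i. \<Sum>l\<in>S. c l * e l i) = (\<Sum>l\<in>S. c l * ip n y (e l))"
  using ip_sum_left[where n = n and S = S and c = c and e = e and y = y] by (simp add: ip_commute)

lemma ip_cong:
  "(\<And>i. i < n \<Longrightarrow> x i = x' i) \<Longrightarrow> (\<And>i. i < n \<Longrightarrow> y i = y' i) \<Longrightarrow> ip n x y = ip n x' y'"
  by (simp add: ip_def)

lemma ip_ge_0 [simp]: "0 \<le> ip n x x"
  by (simp add: ip_def sum_nonneg)

lemma ip_eq_0_iff: "ip n x x = 0 \<longleftrightarrow> (\<forall>i<n. x i = 0)"
  by (auto simp: ip_def sum_nonneg_eq_0_iff)

lemma ip_axis: "j < n \<Longrightarrow> ip n (\<lambda>i. if i = j then 1 else 0) y = y j"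
  by (simp add: ip_def if_distrib[of "\<lambda>x. x * _"] cong: if_cong)

lemma mv_add: "mv n A (\<lambda>i. x i + y i) = (\<lambda>i. mv n A x i + mv n A y i)"
  by (simp add: mv_def fun_eq_iff distrib_left sum.distrib)

lemma mv_scale: "mv n A (\<lambda>i. c * x i) = (\<lambda>i. c * mv n A x i)"
  by (simp add: mv_def fun_eq_iff sum_distrib_left mult_ac)

lemma mv_symm: "symm n A \<Longrightarrow> ip n x (mv n A y) = ip n (mv n A x) y"
  unfolding ip_def mv_def sum_distrib_left sum_distrib_right
  by (subst sum.swap) (auto simp: symm_def mult_ac intro!: sum.cong)

lemma orthonormalD: "orthonormal n k e \<Longrightarrow> i < k \<Longrightarrow> j < k \<Longrightarrow> ip n (e i) (e j) = (if i = j then 1 else 0)"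
  by (simp add: orthonormal_def)

text \<open>\<open>r v\<close> is the Gram-Schmidt residual of \<open>v\<close>, so the second claim
  is Bessel's inequality with its exact defect.\<close>

lemma orthonormal_residual:
  assumes e: "orthonormal n k e"
  defines "r \<equiv> \<lambda>v i. v i - (\<Sum>l<k. ip n v (e l) * e l i)"
  shows "l < k \<Longrightarrow> ip n (r v) (e l) = 0"
    and "ip n (r v) (r v) = ip n v v - (\<Sum>l<k. (ip n v (e l))\<^sup>2)"
proof -
  have 0: "ip n (r v) (e l) = 0" if "l < k" for l v
  proof -
    have "(\<Sum>l'<k. ip n v (e l') * ip n (e l') (e l)) = (\<Sum>l'<k. if l' = l then ip n v (e l') else 0)"
      using that by (intro sum.cong) (auto simp: orthonormalD[OF e])
    then show ?thesis using that by (simp add: r_def ip_diff_left ip_sum_left)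
  qed
  show "l < k \<Longrightarrow> ip n (r v) (e l) = 0" using 0 .
  have "ip n (r v) (r v) = ip n (r v) v - (\<Sum>l<k. ip n v (e l) * ip n (r v) (e l))"
    by (subst (2) r_def) (simp add: ip_diff_right ip_sum_right)
  also have "\<dots> = ip n (r v) v" by (simp add: 0)
  also have "\<dots> = ip n v v - (\<Sum>l<k. (ip n v (e l))\<^sup>2)"
    by (simp add: r_def ip_diff_left ip_sum_left power2_eq_square ip_commute)
  finally show "ip n (r v) (r v) = ip n v v - (\<Sum>l<k. (ip n v (e l))\<^sup>2)" .
qed

text \<open>The residual map is the orthogonal projection onto the complement of the span, and the
  sum is its trace. It does the dimension counting: a positive value lets a system be extended, the
  value zero makes it complete.\<close>

lemma orthonormal_residual_axes:
  assumes e: "orthonormal n k e"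
  shows "(\<Sum>j<n. ip n (\<lambda>i. (if i = j then 1 else 0) - (\<Sum>l<k. e l j * e l i))
           (\<lambda>i. (if i = j then 1 else 0) - (\<Sum>l<k. e l j * e l i))) = real n - real k"
proof -
  have "(\<Sum>j<n. ip n (\<lambda>i. (if i = j then 1 else 0) - (\<Sum>l<k. e l j * e l i))
           (\<lambda>i. (if i = j then 1 else 0) - (\<Sum>l<k. e l j * e l i))) = (\<Sum>j<n. 1 - (\<Sum>l<k. (e l j)\<^sup>2))"
  proof (rule sum.cong[OF refl])
    fix j assume "j \<in> {..<n}"
    then have j: "ip n (\<lambda>i. if i = j then 1 else 0) y = y j" for y
      by (simp add: ip_axis)
    show "ip n (\<lambda>i. (if i = j then 1 else 0) - (\<Sum>l<k. e l j * e l i))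
           (\<lambda>i. (if i = j then 1 else 0) - (\<Sum>l<k. e l j * e l i)) = 1 - (\<Sum>l<k. (e l j)\<^sup>2)"
      using orthonormal_residual(2)[OF e, of "\<lambda>i. if i = j then 1 else 0"]
      unfolding j by simp
  qed
  also have "\<dots> = real n - (\<Sum>l<k. ip n (e l) (e l))"
    by (subst sum_subtractf, subst sum.swap) (simp add: ip_def power2_eq_square)
  also have "\<dots> = real n - real k"
    by (simp add: orthonormalD[OF e])
  finally show ?thesis .
qed

lemma orthonormal_extend:
  assumes e: "orthonormal n k e" and "k < n"
  shows "\<exists>v. ip n v v = 1 \<and> (\<forall>l<k. ip n v (e l) = 0)"
proof -
  define r where "r = (\<lambda>j i. (if i = j then 1 else 0) - (\<Sum>l<k. e l j * e l i))"
  have "(\<Sum>j<n. ip n (r j) (r j)) \<noteq> 0"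
    using orthonormal_residual_axes[OF e] \<open>k < n\<close> by (simp add: r_def)
  then obtain j where j: "j < n" "ip n (r j) (r j) \<noteq> 0"
    by (meson lessThan_iff sum.neutral)
  have orth: "ip n (r j) (e l) = 0" if "l < k" for l
    using orthonormal_residual(1)[OF e that, of "\<lambda>i. if i = j then 1 else 0"] j(1)
    by (simp add: r_def ip_axis)
  define c where "c = 1 / sqrt (ip n (r j) (r j))"
  have "c * (c * ip n (r j) (r j)) = 1"
    using j(2) ip_ge_0[of n "r j"] by (simp add: c_def field_simps)
  then show ?thesis
    using orth by (intro exI[of _ "\<lambda>i. c * r j i"]) (simp add: ip_scale_left ip_scale_right)
qed

text \<open>For \<open>k = n\<close> the squared residuals of the axes sum to zero, so every axis
  equals its expansion in \<open>e\<close>; comparing coordinates gives the resolution of the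
  identity.\<close>

lemma orthonormal_complete:
  assumes e: "orthonormal n n e" and "i < n" "j < n"
  shows "(\<Sum>l<n. e l i * e l j) = (if i = j then 1 else 0)"
proof -
  define r where "r = (\<lambda>j i. (if i = j then 1 else 0) - (\<Sum>l<n. e l j * e l i))"
  have "(\<Sum>j<n. ip n (r j) (r j)) = 0"
    using orthonormal_residual_axes[OF e] by (simp add: r_def)
  then have "ip n (r i) (r i) = 0"
    using \<open>i < n\<close> by (subst (asm) sum_nonneg_eq_0_iff) auto
  then have "r i j = 0" using \<open>j < n\<close> by (simp add: ip_eq_0_iff)
  then show ?thesis by (auto simp: r_def)
qed

lemma parseval:
  assumes e: "orthonormal n n e"
  shows "(\<Sum>l<n. ip n x (e l) * ip n y (e l)) = ip n x y"
proof -
  have "(\<Sum>l<n. ip n x (e l) * ip n y (e l)) = (\<Sum>l<n. \<Sum>i<n. \<Sum>j<n. x i * y j * (e l i * e l j))"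
    unfolding ip_def sum_product by (intro sum.cong refl) (simp add: mult_ac)
  also have "\<dots> = (\<Sum>i<n. \<Sum>l<n. \<Sum>j<n. x i * y j * (e l i * e l j))"
    by (rule sum.swap)
  also have "\<dots> = (\<Sum>i<n. \<Sum>j<n. \<Sum>l<n. x i * y j * (e l i * e l j))"
    by (intro sum.cong refl sum.swap)
  also have "\<dots> = (\<Sum>i<n. \<Sum>j<n. x i * y j * (\<Sum>l<n. e l i * e l j))"
    by (simp only: sum_distrib_left)
  also have "\<dots> = (\<Sum>i<n. \<Sum>j<n. x i * y j * (if i = j then 1 else 0))"
    by (intro sum.cong refl) (simp add: orthonormal_complete[OF e])
  also have "\<dots> = (\<Sum>i<n. \<Sum>j<n. if i = j then x i * y j else 0)"
    by (intro sum.cong refl) simp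
  also have "\<dots> = ip n x y"
    by (simp add: ip_def)
  finally show ?thesis .
qed

text \<open>Forcing the coordinates from \<open>n\<close> on to vanish places the set in a product
  of compact intervals and points, which is compact by Tychonoff; the remaining conditions are
  closed.\<close>

lemma compact_unit_sphere_orth:
  "compact {v :: nat \<Rightarrow> real. (\<forall>i\<ge>n. v i = 0) \<and> ip n v v = 1 \<and> (\<forall>l<k. ip n v (e l) = 0)}"
    (is "compact ?S")
proof -
  have cont: "continuous_on UNIV (\<lambda>v :: nat \<Rightarrow> real. v i)" for i
    by (rule continuous_on_product_coordinates)
  define K where "K = PiE UNIV (\<lambda>i. if i < n then {-1..1::real} else {0})"
  have "compactin (product_topology (\<lambda>i. euclidean) UNIV) K"
    unfolding K_def by (subst compactin_PiE) auto
  then have K: "compact K" by (simp add: euclidean_product_topology)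
  have "?S = (\<Inter>i\<in>{n..}. {v. v i = 0}) \<inter> {v. ip n v v = 1} \<inter> (\<Inter>l\<in>{..<k}. {v. ip n v (e l) = 0})"
    by auto
  moreover have "closed \<dots>"
    unfolding ip_def
    by (intro closed_Int closed_INT ballI closed_Collect_eq continuous_intros cont)
  ultimately have cl: "closed ?S" by simp
  have "v \<in> K" if v: "\<forall>i\<ge>n. v i = 0" "ip n v v = 1" for v
  proof -
    have "(v i)\<^sup>2 \<le> 1" if "i < n" for i
      using v(2) member_le_sum[of i "{..<n}" "\<lambda>i. v i * v i"] that
      by (simp add: ip_def power2_eq_square)
    then show ?thesis using v(1) by (auto simp: K_def abs_square_le_1 abs_le_iff)
  qed
  then have "?S \<subseteq> K" by auto
  then show ?thesis using compact_Int_closed[OF K cl] by (simp add: Int_absorb1)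
qed

lemma quadratic_nonneg_linear_zero:
  fixes c d :: real
  assumes "\<And>t. 0 \<le> 2 * t * c + t\<^sup>2 * d"
  shows "c = 0"
proof (rule ccontr)
  assume "c \<noteq> 0"
  \<comment> \<open>With t = -c/D the expression times D^2 is c^2 (d - 2D), and D is taken positive
    and above d to make this negative.\<close>
  define D where "D = \<bar>d\<bar> + 1"
  have D: "D > 0" "d < D" by (auto simp: D_def)
  have "0 \<le> (2 * (- c / D) * c + (- c / D)\<^sup>2 * d) * D\<^sup>2"
    using assms[of "- c / D"] by simp
  also have "\<dots> = c\<^sup>2 * (d - 2 * D)"
    using D(1) by (simp add: field_simps power2_eq_square)
  also have "\<dots> < 0"
    using \<open>c \<noteq> 0\<close> D by (intro mult_pos_neg) auto
  finally show False by simp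
qed

text \<open>The minimiser \<open>v\<close> of the Rayleigh quotient on the complement of the given
  eigenvectors is an eigenvector: \<open>A v - \<mu> v\<close> is orthogonal to the complement by
  criticality, and lies in it because the complement is invariant under \<open>A\<close>. Minimality
  is recorded in the conclusion because it later orders the eigenvalues.\<close>

lemma eigenpair_orth_complement:
  assumes A: "symm n A" and e: "orthonormal n k e" and k: "k < n"
    and eigval: "\<And>l i. l < k \<Longrightarrow> i < n \<Longrightarrow> mv n A (e l) i = a l * e l i"
  shows "\<exists>\<mu> v. ip n v v = 1 \<and> (\<forall>l<k. ip n v (e l) = 0) \<and> (\<forall>i<n. mv n A v i = \<mu> * v i) \<and>
    (\<forall>w. (\<forall>l<k. ip n w (e l) = 0) \<longrightarrow> \<mu> * ip n w w \<le> ip n w (mv n A w))"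
proof -
  define S where "S = {v :: nat \<Rightarrow> real. (\<forall>i\<ge>n. v i = 0) \<and> ip n v v = 1 \<and> (\<forall>l<k. ip n v (e l) = 0)}"
  define Q where "Q = (\<lambda>v. ip n v (mv n A v))"
  have trunc: "ip n (\<lambda>i. if i < n then v i else 0) w = ip n v w" for v w
    by (rule ip_cong) auto
  then have trunc': "ip n w (\<lambda>i. if i < n then v i else 0) = ip n w v" for v w
    by (simp add: ip_commute[of n w])
  obtain v0 where "ip n v0 v0 = 1" "\<forall>l<k. ip n v0 (e l) = 0"
    using orthonormal_extend[OF e k] by blast
  then have "(\<lambda>i. if i < n then v0 i else 0) \<in> S"
    unfolding S_def mem_Collect_eq
    by (auto simp: trunc trunc')
  then have "S \<noteq> {}" by auto
  moreover have "continuous_on S Q"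
    unfolding Q_def ip_def mv_def
    by (intro continuous_intros continuous_on_subset[OF continuous_on_product_coordinates] subset_UNIV)
  ultimately obtain v where v: "v \<in> S" and min: "\<And>w. w \<in> S \<Longrightarrow> Q v \<le> Q w"
    using continuous_attains_inf[of S Q] compact_unit_sphere_orth[of n k e] unfolding S_def by blast
  define \<mu> where "\<mu> = Q v"
  have v1: "ip n v v = 1" and vo: "\<And>l. l < k \<Longrightarrow> ip n v (e l) = 0"
    using v by (auto simp: S_def)
  \<comment> \<open>Homogeneity carries the minimum from the sphere to the whole complement; the
    normalised vector is truncated beyond \<open>n\<close> to become a member of
    \<open>S\<close>.\<close>
  have low: "\<mu> * ip n w w \<le> Q w" if w: "\<And>l. l < k \<Longrightarrow> ip n w (e l) = 0" for w
  proof (cases "ip n w w = 0")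
    case True
    then have "Q w = 0" unfolding Q_def ip_eq_0_iff by (simp add: ip_def)
    then show ?thesis using True by simp
  next
    case False
    define c where "c = 1 / sqrt (ip n w w)"
    have c: "c * (c * ip n w w) = 1" "c * c = 1 / ip n w w"
      using False ip_ge_0[of n w] by (simp_all add: c_def field_simps)
    define w' where "w' = (\<lambda>i. c * w i)"
    define w'' where "w'' = (\<lambda>i. if i < n then w' i else 0)"
    have "ip n w'' w'' = 1" "\<And>l. l < k \<Longrightarrow> ip n w'' (e l) = 0"
      using c w by (simp_all add: w''_def w'_def trunc trunc' ip_scale_left ip_scale_right)
    then have "w'' \<in> S" by (simp add: S_def w''_def)
    then have "\<mu> \<le> Q w''" using min by (simp add: \<mu>_def)
    also have "Q w'' = Q w'"
      unfolding Q_def by (rule ip_cong) (auto simp: w''_def mv_def)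
    also have "\<dots> = Q w / ip n w w"
      using c(2) by (simp add: Q_def w'_def mv_scale ip_scale_left ip_scale_right flip: mult.assoc)
    finally show ?thesis using False ip_ge_0[of n w] by (simp add: field_simps)
  qed
  \<comment> \<open>First-order condition along the line \<open>v + t w\<close>: the quadratic
    polynomial in t is nonnegative and has no constant term.\<close>
  have crit: "ip n w (mv n A v) - \<mu> * ip n w v = 0" if w: "\<And>l. l < k \<Longrightarrow> ip n w (e l) = 0" for w
  proof (rule quadratic_nonneg_linear_zero)
    fix t
    define u where "u = (\<lambda>i. v i + t * w i)"
    have "\<mu> * ip n u u \<le> Q u"
      by (rule low) (simp add: u_def ip_add_left ip_scale_left vo w)
    moreover have "ip n v (mv n A w) = ip n w (mv n A v)"
      using mv_symm[OF A] by (metis ip_commute)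
    then have "Q u = \<mu> + 2 * t * ip n w (mv n A v) + t\<^sup>2 * Q w"
      by (simp add: Q_def u_def mv_add mv_scale ip_add_left ip_add_right ip_scale_left ip_scale_right
          power2_eq_square \<mu>_def algebra_simps)
    moreover have "ip n u u = 1 + 2 * t * ip n w v + t\<^sup>2 * ip n w w"
      by (simp add: u_def ip_add_left ip_add_right ip_scale_left ip_scale_right
          power2_eq_square v1 ip_commute[of n v w] algebra_simps)
    ultimately show "0 \<le> 2 * t * (ip n w (mv n A v) - \<mu> * ip n w v) + t\<^sup>2 * (Q w - \<mu> * ip n w w)"
      by (simp add: algebra_simps)
  qed
  define z where "z = (\<lambda>i. mv n A v i - \<mu> * v i)"
  have "ip n (mv n A v) (e l) = 0" if "l < k" for l
  proof -
    have "ip n (mv n A v) (e l) = ip n v (mv n A (e l))" by (simp add: mv_symm[OF A])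
    also have "\<dots> = ip n v (\<lambda>i. a l * e l i)" by (rule ip_cong) (simp_all add: eigval that)
    also have "\<dots> = 0" by (simp add: ip_scale_right vo that)
    finally show ?thesis .
  qed
  then have "ip n z (e l) = 0" if "l < k" for l
    using that by (simp add: z_def ip_diff_left ip_scale_left vo)
  from crit[OF this] have "ip n z z = 0"
    by (subst (2) z_def) (simp add: ip_diff_right ip_scale_right)
  then have "\<forall>i<n. mv n A v i = \<mu> * v i"
    by (simp add: ip_eq_0_iff z_def)
  moreover have "\<forall>w. (\<forall>l<k. ip n w (e l) = 0) \<longrightarrow> \<mu> * ip n w w \<le> ip n w (mv n A w)"
  proof (intro allI impI)
    fix w assume "\<forall>l<k. ip n w (e l) = 0"
    then show "\<mu> * ip n w w \<le> ip n w (mv n A w)"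
      using low[of w] unfolding Q_def by blast
  qed
  moreover have "\<forall>l<k. ip n v (e l) = 0" using vo by blast
  ultimately show ?thesis using v1 by (intro exI conjI)
qed

text \<open>The ordering makes \<open>a 0\<close> the smallest eigenvalue and makes the resolvent
  eigenvalues decrease in the index, as Abel summation will require.\<close>

definition eigensystem :: "nat \<Rightarrow> (nat \<Rightarrow> nat \<Rightarrow> real) \<Rightarrow> (nat \<Rightarrow> real) \<Rightarrow> (nat \<Rightarrow> nat \<Rightarrow> real) \<Rightarrow> bool" where
  "eigensystem n A a e \<longleftrightarrow> orthonormal n n e \<and> (\<forall>l<n. \<forall>i<n. mv n A (e l) i = a l * e l i) \<and>
     (\<forall>l l'. l \<le> l' \<longrightarrow> l' < n \<longrightarrow> a l \<le> a l')"

text \<open>Eigenvectors are peeled off one at a time. The induction also carries the minimality of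
  \<open>a l\<close> on the complement of the earlier vectors; testing it at a later
  \<open>e l'\<close> sorts the eigenvalues.\<close>

lemma spectral_theorem:
  assumes A: "symm n A"
  shows "\<exists>a e. eigensystem n A a e"
proof -
  have "\<exists>a e. orthonormal n k e \<and> (\<forall>l<k. \<forall>i<n. mv n A (e l) i = a l * e l i) \<and>
      (\<forall>l<k. \<forall>w. (\<forall>l'<l. ip n w (e l') = 0) \<longrightarrow> a l * ip n w w \<le> ip n w (mv n A w))" if "k \<le> n" for k
    using that
  proof (induction k)
    case 0
    then show ?case by (simp add: orthonormal_def)
  next
    case (Suc k)
    from Suc.IH[OF Suc_leD[OF Suc.prems]] obtain a e where e: "orthonormal n k e"
      and "\<forall>l<k. \<forall>i<n. mv n A (e l) i = a l * e l i"
      and "\<forall>l<k. \<forall>w. (\<forall>l'<l. ip n w (e l') = 0) \<longrightarrow> a l * ip n w w \<le> ip n w (mv n A w)"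
      by (elim exE conjE)
    then have eigval: "\<And>l i. l < k \<Longrightarrow> i < n \<Longrightarrow> mv n A (e l) i = a l * e l i"
      and low: "\<And>l w. l < k \<Longrightarrow> \<forall>l'<l. ip n w (e l') = 0 \<Longrightarrow> a l * ip n w w \<le> ip n w (mv n A w)"
      by simp_all
    obtain \<mu> v where v: "ip n v v = 1" "\<forall>l<k. ip n v (e l) = 0" "\<forall>i<n. mv n A v i = \<mu> * v i"
      "\<forall>w. (\<forall>l<k. ip n w (e l) = 0) \<longrightarrow> \<mu> * ip n w w \<le> ip n w (mv n A w)"
      using eigenpair_orth_complement[where a = a, OF A e Suc_le_lessD[OF Suc.prems]] eigval
      by (metis (no_types, lifting))
    have "orthonormal n (Suc k) (e(k := v))"
      using v(1,2) e by (auto simp: orthonormal_def less_Suc_eq ip_commute[of n "e _" v])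
    moreover have "\<forall>l<Suc k. \<forall>i<n. mv n A ((e(k := v)) l) i = (a(k := \<mu>)) l * (e(k := v)) l i"
      using v(3) eigval by (simp add: less_Suc_eq all_conj_distrib)
    moreover have "\<forall>l<Suc k. \<forall>w. (\<forall>l'<l. ip n w ((e(k := v)) l') = 0) \<longrightarrow>
        (a(k := \<mu>)) l * ip n w w \<le> ip n w (mv n A w)"
      using v(4) low by (auto simp: less_Suc_eq)
    ultimately show ?case by (intro exI conjI)
  qed
  from this[OF order_refl] obtain a e where e: "orthonormal n n e"
      and "\<forall>l<n. \<forall>i<n. mv n A (e l) i = a l * e l i"
      and "\<forall>l<n. \<forall>w. (\<forall>l'<l. ip n w (e l') = 0) \<longrightarrow> a l * ip n w w \<le> ip n w (mv n A w)"
    by (elim exE conjE)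
  then have eigval: "\<And>l i. l < n \<Longrightarrow> i < n \<Longrightarrow> mv n A (e l) i = a l * e l i"
      and low: "\<And>l w. l < n \<Longrightarrow> \<forall>l'<l. ip n w (e l') = 0 \<Longrightarrow> a l * ip n w w \<le> ip n w (mv n A w)"
    by simp_all
  have "a l \<le> a l'" if "l \<le> l'" "l' < n" for l l'
  proof -
    have "ip n (e l') (mv n A (e l')) = ip n (e l') (\<lambda>i. a l' * e l' i)"
      using that by (intro ip_cong) (simp_all add: eigval)
    then have "a l * 1 \<le> a l'"
      using low[of l "e l'"] that by (simp add: orthonormalD[OF e] ip_scale_right)
    then show ?thesis by simp
  qed
  then show ?thesis using e eigval unfolding eigensystem_def by blast
qed

section \<open>Rank-one updates of the resolvent trace\<close>

lemma eigensystemD: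
  assumes "eigensystem n A a e"
  shows "orthonormal n n e" "l < n \<Longrightarrow> i < n \<Longrightarrow> mv n A (e l) i = a l * e l i"
    "l \<le> l' \<Longrightarrow> l' < n \<Longrightarrow> a l \<le> a l'"
  using assms by (auto simp: eigensystem_def)

lemma ip_eigenvector:
  assumes A: "symm n A" and e: "eigensystem n A a e" and l: "l < n"
  shows "ip n (mv n A w) (e l) = a l * ip n w (e l)"
proof -
  have "ip n (mv n A w) (e l) = ip n w (mv n A (e l))" by (simp add: mv_symm[OF A])
  also have "\<dots> = ip n w (\<lambda>i. a l * e l i)" using l by (intro ip_cong) (simp_all add: eigensystemD[OF e])
  finally show ?thesis by (simp add: ip_scale_right)
qed

lemma quadratic_form_eigensystem:
  assumes A: "symm n A" and e: "eigensystem n A a e"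
  shows "ip n w (mv n A w) = (\<Sum>l<n. a l * (ip n w (e l))\<^sup>2)"
proof -
  have "ip n w (mv n A w) = (\<Sum>l<n. ip n w (e l) * ip n (mv n A w) (e l))"
    by (simp add: parseval[OF eigensystemD(1)[OF e]])
  also have "\<dots> = (\<Sum>l<n. a l * (ip n w (e l))\<^sup>2)"
    by (intro sum.cong) (simp_all add: ip_eigenvector[OF A e] power2_eq_square)
  finally show ?thesis .
qed

lemma least_eigenvalue_le_quadratic_form:
  assumes A: "symm n A" and e: "eigensystem n A a e"
  shows "a 0 * ip n w w \<le> ip n w (mv n A w)"
proof -
  have "a 0 * ip n w w = (\<Sum>l<n. a 0 * (ip n w (e l))\<^sup>2)"
    unfolding sum_distrib_left[symmetric] using parseval[OF eigensystemD(1)[OF e], of w w]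
    by (simp add: power2_eq_square)
  also have "\<dots> \<le> (\<Sum>l<n. a l * (ip n w (e l))\<^sup>2)"
    by (intro sum_mono mult_right_mono) (auto intro: eigensystemD(3)[OF e])
  finally show ?thesis by (simp add: quadratic_form_eigensystem[OF A e])
qed

lemma quadratic_form_least_eigenvector:
  assumes e: "eigensystem n A a e" and "n \<ge> 1"
  shows "ip n (e 0) (mv n A (e 0)) = a 0"
proof -
  have "ip n (e 0) (mv n A (e 0)) = ip n (e 0) (\<lambda>i. a 0 * e 0 i)"
    using \<open>n \<ge> 1\<close> by (intro ip_cong) (simp_all add: eigensystemD[OF e])
  then show ?thesis
    using \<open>n \<ge> 1\<close> by (simp add: ip_scale_right orthonormalD[OF eigensystemD(1)[OF e]])
qed

text \<open>The values and the vectors are components of one and the same chosen pair, so that they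
  form an eigensystem together.\<close>

definition eigval :: "nat \<Rightarrow> (nat \<Rightarrow> nat \<Rightarrow> real) \<Rightarrow> nat \<Rightarrow> real" where
  "eigval n A = fst (SOME p. eigensystem n A (fst p) (snd p))"

definition eigvec :: "nat \<Rightarrow> (nat \<Rightarrow> nat \<Rightarrow> real) \<Rightarrow> nat \<Rightarrow> nat \<Rightarrow> real" where
  "eigvec n A = snd (SOME p. eigensystem n A (fst p) (snd p))"

lemma eigensystem_eigval: "symm n A \<Longrightarrow> eigensystem n A (eigval n A) (eigvec n A)"
  using spectral_theorem[of n A] unfolding eigval_def eigvec_def
  by (metis (mono_tags, lifting) fst_conv snd_conv someI_ex)

definition rank_one_add :: "(nat \<Rightarrow> nat \<Rightarrow> real) \<Rightarrow> (nat \<Rightarrow> real) \<Rightarrow> nat \<Rightarrow> nat \<Rightarrow> real" where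
  "rank_one_add A x i j = A i j + x i * x j"

lemma symm_rank_one_add: "symm n A \<Longrightarrow> symm n (rank_one_add A x)"
  by (simp add: symm_def rank_one_add_def mult.commute)

lemma mv_rank_one_add: "mv n (rank_one_add A x) w = (\<lambda>i. mv n A w i + ip n x w * x i)"
  by (simp add: mv_def rank_one_add_def ip_def fun_eq_iff distrib_right distrib_left sum.distrib sum_distrib_left mult_ac)

text \<open>The quadratic form of \<open>A\<close> is evaluated at the least eigenvector of the
  updated matrix, where the update contributes a square.\<close>

lemma eigval_0_rank_one_add:
  assumes A: "symm n A" and "n \<ge> 1"
  shows "eigval n A 0 \<le> eigval n (rank_one_add A x) 0"
proof -
  note e = eigensystem_eigval[OF A] and e' = eigensystem_eigval[OF symm_rank_one_add[OF A], of x]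
  define v where "v = eigvec n (rank_one_add A x) 0"
  have v: "ip n v v = 1"
    using \<open>n \<ge> 1\<close> by (simp add: v_def orthonormalD[OF eigensystemD(1)[OF e']])
  have "eigval n (rank_one_add A x) 0 = ip n v (mv n A v) + (ip n x v)\<^sup>2"
    using quadratic_form_least_eigenvector[OF e' \<open>n \<ge> 1\<close>]
    by (simp add: v_def mv_rank_one_add ip_add_right ip_scale_right power2_eq_square ip_commute[of n _ x])
  then show ?thesis
    using least_eigenvalue_le_quadratic_form[OF A e, of v] by (simp add: v add_increasing2)
qed

text \<open>With \<open>c i j\<close> the overlaps of the two eigenbases, \<open>(a' j - a i) c i j = x\<^sub>i x'\<^sub>j\<close>; summing the
  resulting relations between resolvent eigenvalues replaces the matrix identity of Sherman and Morrison.\<close>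

lemma rank_one_update_trace:
  assumes A: "symm n A" and e: "eigensystem n A a e" and e': "eigensystem n (rank_one_add A x) a' e'"
    and u: "\<And>l. l < n \<Longrightarrow> u < a l" and u': "\<And>l. l < n \<Longrightarrow> u < a' l"
  defines "b \<equiv> \<lambda>l. 1 / (a l - u)"
  shows "(\<Sum>l<n. 1 / (a' l - u)) = (\<Sum>l<n. b l) -
    (\<Sum>l<n. (b l)\<^sup>2 * (ip n x (e l))\<^sup>2) / (1 + (\<Sum>l<n. b l * (ip n x (e l))\<^sup>2))"
proof -
  define b' where "b' = (\<lambda>l. 1 / (a' l - u))"
  define c where "c = (\<lambda>i j. ip n (e i) (e' j))"
  define X where "X = (\<lambda>i. ip n x (e i))"
  define X' where "X' = (\<lambda>j. ip n x (e' j))"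
  define q where "q = (\<Sum>i<n. b i * (X i)\<^sup>2)"
  define s where "s = (\<Sum>i<n. (b i)\<^sup>2 * (X i)\<^sup>2)"
  note on = eigensystemD(1)[OF e] and on' = eigensystemD(1)[OF e']
  have q0: "0 \<le> q"
    unfolding q_def b_def by (intro sum_nonneg mult_nonneg_nonneg) (auto intro: less_imp_le u)
  \<comment> \<open>Evaluating the updated form at \<open>e i\<close> and \<open>e' j\<close>
    through either eigenbasis gives the relation between eigenvalues; multiplying by
    \<open>b i * b' j\<close> turns it into one between resolvents.\<close>
  have rel: "(b i - b' j) * c i j = b i * b' j * X i * X' j" if ij: "i < n" "j < n" for i j
  proof -
    have "a' j * c i j = ip n (e i) (mv n (rank_one_add A x) (e' j))"
      using ip_eigenvector[OF symm_rank_one_add[OF A] e' ij(2), of "e i"] mv_symm[OF symm_rank_one_add[OF A], of "e i" x "e' j"]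
      by (simp add: c_def)
    also have "\<dots> = a i * c i j + X i * X' j"
      using ip_eigenvector[OF A e ij(1), of "e' j"]
      by (simp add: mv_rank_one_add ip_add_right ip_scale_right c_def X_def X'_def ip_commute)
    finally have "(a' j - a i) * c i j = X i * X' j" by (simp add: algebra_simps)
    moreover have "b i - b' j = b i * b' j * (a' j - a i)"
      using u[OF ij(1)] u'[OF ij(2)] by (simp add: b_def b'_def field_simps)
    ultimately show ?thesis by (simp add: mult_ac)
  qed
  have X': "X' j = (\<Sum>i<n. X i * c i j)" if "j < n" for j
    using parseval[OF on, of x "e' j"] by (simp add: X_def X'_def c_def ip_commute)
  have c1: "(\<Sum>i<n. c i j * c i j) = 1" if "j < n" for j
    using parseval[OF on, of "e' j" "e' j"] orthonormalD[OF on' that that]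
    by (simp add: c_def ip_commute)
  have c2: "(\<Sum>j<n. c i j * c i j) = 1" if "i < n" for i
    using parseval[OF on', of "e i" "e i"] orthonormalD[OF on that that]
    by (simp add: c_def)
  \<comment> \<open>In coordinates of the new basis this says B x = (1 + q) B' x, the
    Sherman-Morrison formula applied to x.\<close>
  have mix: "(\<Sum>i<n. b i * X i * c i j) = (1 + q) * (b' j * X' j)" if j: "j < n" for j
  proof -
    have "(\<Sum>i<n. b i * X i * c i j) - b' j * X' j = (\<Sum>i<n. X i * ((b i - b' j) * c i j))"
      by (simp add: X'[OF j] sum_distrib_left sum_subtractf algebra_simps)
    also have "\<dots> = (\<Sum>i<n. b' j * X' j * (b i * (X i)\<^sup>2))"
      by (intro sum.cong refl) (simp add: rel[OF _ j] power2_eq_square)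
    also have "\<dots> = b' j * X' j * q" by (simp add: q_def sum_distrib_left)
    finally show ?thesis by (simp add: algebra_simps)
  qed
  \<comment> \<open>\<open>s\<close> is the squared norm of B x, computed here in the new basis by
    Parseval.\<close>
  have "s = (\<Sum>j<n. (\<Sum>i<n. b i * X i * c i j)\<^sup>2)"
  proof -
    define v where "v = (\<lambda>k. \<Sum>i<n. (b i * X i) * e i k)"
    have "ip n v v = (\<Sum>i<n. (b i * X i) * ip n (e i) v)"
      by (subst (1) v_def) (simp add: ip_sum_left)
    also have "\<dots> = (\<Sum>i<n. (b i * X i) * (\<Sum>i'<n. (b i' * X i') * (if i = i' then 1 else 0)))"
      by (intro sum.cong refl) (simp add: v_def ip_sum_right orthonormalD[OF on])
    also have "\<dots> = (\<Sum>i<n. (b i * X i) * (\<Sum>i'<n. if i = i' then b i' * X i' else 0))"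
      by (intro sum.cong refl arg_cong2[of _ _ _ _ "(*)"]) auto
    also have "\<dots> = s"
      by (simp add: s_def power2_eq_square mult_ac)
    finally have "ip n v v = s" .
    moreover have "ip n v (e' j) = (\<Sum>i<n. b i * X i * c i j)" for j
      by (simp add: v_def ip_sum_left c_def)
    ultimately show ?thesis
      using parseval[OF on', of v v] by (simp add: power2_eq_square)
  qed
  also have "\<dots> = (1 + q) * ((1 + q) * (\<Sum>j<n. (b' j * X' j)\<^sup>2))"
    unfolding sum_distrib_left
    by (intro sum.cong refl, subst mix) (auto simp: power2_eq_square)
  finally have s: "s / (1 + q) = (1 + q) * (\<Sum>j<n. (b' j * X' j)\<^sup>2)"
    using q0 by (simp add: field_simps)
  \<comment> \<open>Each trace is spread over all pairs of basis vectors by the unit sums of squared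
    overlaps; then \<open>rel\<close> and \<open>mix\<close> apply to the difference.\<close>
  have "(\<Sum>i<n. b i) - (\<Sum>j<n. b' j) = (\<Sum>i<n. b i * (\<Sum>j<n. c i j * c i j)) - (\<Sum>j<n. b' j * (\<Sum>i<n. c i j * c i j))"
    by (simp add: c1 c2)
  also have "\<dots> = (\<Sum>j<n. \<Sum>i<n. b i * c i j * c i j) - (\<Sum>j<n. \<Sum>i<n. b' j * c i j * c i j)"
    unfolding sum_distrib_left mult.assoc by (subst sum.swap) simp
  also have "\<dots> = (\<Sum>j<n. \<Sum>i<n. ((b i - b' j) * c i j) * c i j)"
    by (simp add: sum_subtractf algebra_simps)
  also have "\<dots> = (\<Sum>j<n. b' j * X' j * (\<Sum>i<n. b i * X i * c i j))"
    unfolding sum_distrib_left by (intro sum.cong refl) (simp add: rel)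
  also have "\<dots> = (\<Sum>j<n. b' j * X' j * ((1 + q) * (b' j * X' j)))"
    by (intro sum.cong refl) (simp add: mix)
  also have "\<dots> = s / (1 + q)"
    unfolding s sum_distrib_left by (intro sum.cong refl) (simp add: power2_eq_square)
  finally show ?thesis by (simp add: b'_def s_def q_def X_def)
qed

definition Phi :: "nat \<Rightarrow> (nat \<Rightarrow> nat \<Rightarrow> real) \<Rightarrow> real \<Rightarrow> real" where
  "Phi n A u = (\<Sum>l<n. 1 / (eigval n A l - u))"

definition resolvent_eigval :: "nat \<Rightarrow> (nat \<Rightarrow> nat \<Rightarrow> real) \<Rightarrow> real \<Rightarrow> nat \<Rightarrow> real" where
  "resolvent_eigval n A u l = 1 / (eigval n A l - u)"

lemma eigval_0_le: "symm n A \<Longrightarrow> l < n \<Longrightarrow> eigval n A 0 \<le> eigval n A l"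
  using eigensystemD(3)[OF eigensystem_eigval, of n A 0 l] by simp

lemma Phi_nonneg: "symm n A \<Longrightarrow> u < eigval n A 0 \<Longrightarrow> 0 \<le> Phi n A u"
  unfolding Phi_def by (intro sum_nonneg) (simp add: order.strict_implies_order[OF less_le_trans[OF _ eigval_0_le]])

lemma Phi_rank_one_add:
  assumes A: "symm n A" and u: "u < eigval n A 0" and "n \<ge> 1"
  shows "Phi n (rank_one_add A x) u = Phi n A u -
    (\<Sum>l<n. (resolvent_eigval n A u l)\<^sup>2 * (ip n x (eigvec n A l))\<^sup>2) /
      (1 + (\<Sum>l<n. resolvent_eigval n A u l * (ip n x (eigvec n A l))\<^sup>2))"
  unfolding Phi_def resolvent_eigval_def
proof (rule rank_one_update_trace[OF A eigensystem_eigval[OF A] eigensystem_eigval[OF symm_rank_one_add[OF A]]])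
  fix l assume "l < n"
  then show "u < eigval n A l" "u < eigval n (rank_one_add A x) l"
    using u eigval_0_le[OF A, of l] eigval_0_le[OF symm_rank_one_add[OF A, of x], of l] eigval_0_rank_one_add[OF A \<open>n \<ge> 1\<close>, of x]
    by linarith+
qed

text \<open>For decreasing nonnegative weights this writes a weighted sum as a nonnegative
  combination of partial sums. It reduces quadratic forms in the resolvent to projections onto
  leading eigenvectors.\<close>

lemma abel_summation:
  fixes b y :: "nat \<Rightarrow> real"
  shows "(\<Sum>i<n. b i * y i) = (\<Sum>r<n. (b r - b (Suc r)) * (\<Sum>i<Suc r. y i)) + b n * (\<Sum>i<n. y i)"
  by (induction n) (simp_all add: algebra_simps)

section \<open>The expected change of the potential\<close>

locale isotropic_vector = prob_space D for D :: "'d measure" +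
  fixes n :: nat and \<xi> :: "'d \<Rightarrow> nat \<Rightarrow> real"
  assumes meas [measurable]: "\<And>i. i < n \<Longrightarrow> (\<lambda>w. \<xi> w i) \<in> borel_measurable D"
    and cov: "\<And>i j. i < n \<Longrightarrow> j < n \<Longrightarrow>
      has_bochner_integral D (\<lambda>w. \<xi> w i * \<xi> w j) (if i = j then 1 else 0)"
begin

lemma ip_measurable [measurable]: "(\<lambda>w. ip n (\<xi> w) y) \<in> borel_measurable D"
  unfolding ip_def by (intro borel_measurable_sum borel_measurable_times meas) auto

lemma second_moment: "has_bochner_integral D (\<lambda>w. (ip n (\<xi> w) y)\<^sup>2) (ip n y y)"
proof -
  have "has_bochner_integral D (\<lambda>w. \<Sum>i<n. \<Sum>j<n. (y i * y j) * (\<xi> w i * \<xi> w j))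
      (\<Sum>i<n. \<Sum>j<n. (y i * y j) * (if i = j then 1 else 0))"
    by (intro has_bochner_integral_sum has_bochner_integral_mult_right cov) auto
  moreover have "(\<Sum>i<n. \<Sum>j<n. (y i * y j) * (if i = j then 1 else 0)) = ip n y y"
    by (simp add: ip_def if_distrib[of "\<lambda>x. _ * x"] cong: if_cong)
  moreover have "(\<lambda>w. \<Sum>i<n. \<Sum>j<n. (y i * y j) * (\<xi> w i * \<xi> w j)) = (\<lambda>w. (ip n (\<xi> w) y)\<^sup>2)"
    by (simp add: ip_def power2_eq_square sum_product mult_ac)
  ultimately show ?thesis by simp
qed

lemma integrable_second_moment [simp]: "integrable D (\<lambda>w. (ip n (\<xi> w) y)\<^sup>2)"
  using second_moment by (auto simp: has_bochner_integral_iff)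

lemma integral_second_moment [simp]: "(\<integral>w. (ip n (\<xi> w) y)\<^sup>2 \<partial>D) = ip n y y"
  using second_moment by (auto simp: has_bochner_integral_iff)

end

text \<open>Conditions (a) and (b) in quantitative form. Events of probability at most \<eta> carry
  little second moment in any direction, and the expected excess of a projected squared norm over
  its rank grows with slope \<open>\<epsilon>\<^sub>1\<close>, up to a constant \<open>R\<close>
  that absorbs the small ranks.\<close>

locale regular_vector = isotropic_vector +
  fixes \<epsilon> \<eta> R \<epsilon>\<^sub>1 :: real
  assumes n_pos: "n \<ge> 1" and \<epsilon>: "0 < \<epsilon>" "\<epsilon> < 1" and \<eta>: "0 < \<eta>" "\<eta> \<le> 1" and R: "0 \<le> R"
    and unif_int: "\<And>G y. G \<in> sets D \<Longrightarrow> prob G \<le> \<eta> \<Longrightarrow> ip n y y = 1 \<Longrightarrow>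
      (\<integral>w. (ip n (\<xi> w) y)\<^sup>2 * indicator G w \<partial>D) \<le> \<epsilon>"
    and proj_conc: "\<And>e r. orthonormal n n e \<Longrightarrow> r \<le> n \<Longrightarrow>
      (\<integral>w. max 0 ((\<Sum>i<r. (ip n (\<xi> w) (e i))\<^sup>2) - real r) \<partial>D) \<le> \<epsilon>\<^sub>1 * real r + R"
begin

text \<open>Abel summation makes the form a nonnegative mixture of projections with weights
  \<open>d r\<close>, and the positive part is subadditive. The weights sum to \<open>b 0\<close>,
  which is the norm of the resolvent, and weighted by the ranks they sum to its trace.\<close>

lemma quadratic_excess:
  assumes e: "orthonormal n n e"
    and b0: "\<And>i. i < n \<Longrightarrow> 0 \<le> b i" and anti: "\<And>i j. i \<le> j \<Longrightarrow> j < n \<Longrightarrow> b j \<le> b i"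
  shows "(\<integral>w. max 0 ((\<Sum>i<n. b i * (ip n (\<xi> w) (e i))\<^sup>2) - (\<Sum>i<n. b i)) \<partial>D) \<le> \<epsilon>\<^sub>1 * (\<Sum>i<n. b i) + R * b 0"
proof -
  \<comment> \<open>Cutting \<open>b\<close> off to zero at \<open>n\<close> removes the boundary
    term of Abel summation and lets the differences telescope to \<open>b 0\<close>.\<close>
  define c where "c = (\<lambda>i. if i < n then b i else 0)"
  define d where "d = (\<lambda>r. c r - c (Suc r))"
  define E where "E = (\<lambda>w r. max 0 ((\<Sum>i<r. (ip n (\<xi> w) (e i))\<^sup>2) - real r))"
  have d0: "0 \<le> d r" if "r < n" for r
    using that b0 anti[of r "Suc r"] by (auto simp: d_def c_def)
  have int [simp]: "integrable D (\<lambda>w. E w r)" for r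
    unfolding E_def by (intro integrable_max integrable_const Bochner_Integration.integrable_diff
        Bochner_Integration.integrable_sum integrable_second_moment)
  have abel: "(\<Sum>i<n. b i * y i) = (\<Sum>r<n. d r * (\<Sum>i<Suc r. y i))" for y
    using abel_summation[where n = n and b = c and y = y] by (simp add: c_def d_def)
  have dsum: "(\<Sum>r<n. d r) = b 0"
    using sum_lessThan_telescope'[of c n] n_pos by (simp add: d_def c_def)
  have bsum: "(\<Sum>i<n. b i) = (\<Sum>r<n. d r * real (Suc r))"
    using abel[of "\<lambda>_. 1"] by simp
  have pt: "max 0 ((\<Sum>i<n. b i * (ip n (\<xi> w) (e i))\<^sup>2) - (\<Sum>i<n. b i)) \<le> (\<Sum>r<n. d r * E w (Suc r))" for w
  proof (rule max.boundedI)
    show "0 \<le> (\<Sum>r<n. d r * E w (Suc r))"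
      by (intro sum_nonneg mult_nonneg_nonneg) (auto simp: d0 E_def)
    have "(\<Sum>i<n. b i * (ip n (\<xi> w) (e i))\<^sup>2) - (\<Sum>i<n. b i)
        = (\<Sum>r<n. d r * ((\<Sum>i<Suc r. (ip n (\<xi> w) (e i))\<^sup>2) - real (Suc r)))"
      unfolding abel[of "\<lambda>i. (ip n (\<xi> w) (e i))\<^sup>2"] bsum sum_subtractf[symmetric] right_diff_distrib ..
    also have "\<dots> \<le> (\<Sum>r<n. d r * E w (Suc r))"
      by (intro sum_mono mult_left_mono) (auto simp: d0 E_def)
    finally show "(\<Sum>i<n. b i * (ip n (\<xi> w) (e i))\<^sup>2) - (\<Sum>i<n. b i) \<le> (\<Sum>r<n. d r * E w (Suc r))" .
  qed
  have "(\<integral>w. max 0 ((\<Sum>i<n. b i * (ip n (\<xi> w) (e i))\<^sup>2) - (\<Sum>i<n. b i)) \<partial>D)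
      \<le> (\<integral>w. (\<Sum>r<n. d r * E w (Suc r)) \<partial>D)"
    by (intro integral_mono pt integrable_max integrable_const Bochner_Integration.integrable_diff
        Bochner_Integration.integrable_sum integrable_second_moment integrable_mult_right int)
  also have "\<dots> = (\<Sum>r<n. d r * (\<integral>w. E w (Suc r) \<partial>D))"
    by (subst Bochner_Integration.integral_sum) simp_all
  also have "\<dots> \<le> (\<Sum>r<n. d r * (\<epsilon>\<^sub>1 * real (Suc r) + R))"
    using proj_conc[OF e] by (intro sum_mono mult_left_mono) (simp_all add: d0 E_def del: of_nat_Suc sum.lessThan_Suc)
  also have "\<dots> = \<epsilon>\<^sub>1 * (\<Sum>i<n. b i) + R * b 0"
    unfolding bsum dsum[symmetric] by (simp add: sum_distrib_left sum.distrib algebra_simps)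
  finally show ?thesis .
qed

text \<open>Off the exceptional event the denominator is at most 1 + \<tau>. On it, uniform
  integrability costs at most \<epsilon> of the unit second moment in each eigendirection.\<close>

lemma resolvent_loss:
  assumes e: "orthonormal n n e" and b0: "\<And>i. i < n \<Longrightarrow> 0 \<le> b i" and \<tau>: "0 \<le> \<tau>"
    and tail: "prob {w \<in> space D. \<tau> < (\<Sum>i<n. b i * (ip n (\<xi> w) (e i))\<^sup>2)} \<le> \<eta>"
  defines "F \<equiv> \<lambda>w. (\<Sum>i<n. (b i)\<^sup>2 * (ip n (\<xi> w) (e i))\<^sup>2) / (1 + (\<Sum>i<n. b i * (ip n (\<xi> w) (e i))\<^sup>2))"
  shows "integrable D F" and "(1 - \<epsilon>) / (1 + \<tau>) * (\<Sum>i<n. (b i)\<^sup>2) \<le> (\<integral>w. F w \<partial>D)"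
proof -
  define q where "q = (\<lambda>w. \<Sum>i<n. b i * (ip n (\<xi> w) (e i))\<^sup>2)"
  define s where "s = (\<lambda>w. \<Sum>i<n. (b i)\<^sup>2 * (ip n (\<xi> w) (e i))\<^sup>2)"
  define G where "G = {w \<in> space D. \<tau> < q w}"
  have [measurable]: "q \<in> borel_measurable D" "s \<in> borel_measurable D"
    unfolding q_def s_def by measurable
  have G [measurable]: "G \<in> sets D" unfolding G_def by measurable
  have tailG: "prob G \<le> \<eta>" using tail by (simp add: G_def q_def)
  have q0: "0 \<le> q w" for w unfolding q_def by (intro sum_nonneg mult_nonneg_nonneg) (auto simp: b0)
  have s0: "0 \<le> s w" for w unfolding s_def by (intro sum_nonneg mult_nonneg_nonneg) auto
  have F: "F = (\<lambda>w. s w / (1 + q w))" by (simp add: F_def s_def q_def)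
  have s_int: "integrable D s"
    unfolding s_def by (intro Bochner_Integration.integrable_sum integrable_mult_right integrable_second_moment)
  have F_le: "F w \<le> s w" for w
    using q0[of w] s0[of w] by (simp add: F field_simps mult_nonneg_nonneg)
  have F0: "0 \<le> F w" for w using q0[of w] s0[of w] by (simp add: F)
  show F_int: "integrable D F"
  proof (rule Bochner_Integration.integrable_bound[OF s_int])
    show "F \<in> borel_measurable D" unfolding F by measurable
    show "AE w in D. norm (F w) \<le> norm (s w)"
      using F_le F0 s0 by simp
  qed
  have int_ind: "integrable D (\<lambda>w. (ip n (\<xi> w) y)\<^sup>2 * indicator G w)" for y
    by (intro integrable_real_mult_indicator G integrable_second_moment)
  have "(1 - \<epsilon>) * (\<Sum>i<n. (b i)\<^sup>2) = (\<Sum>i<n. (b i)\<^sup>2 * (1 - \<epsilon>))"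
    by (simp add: sum_distrib_left mult.commute)
  also have "\<dots> \<le> (\<Sum>i<n. (b i)\<^sup>2 * (\<integral>w. (ip n (\<xi> w) (e i))\<^sup>2 - (ip n (\<xi> w) (e i))\<^sup>2 * indicator G w \<partial>D))"
  proof (intro sum_mono mult_left_mono zero_le_power2)
    fix i assume "i \<in> {..<n}"
    then have "ip n (e i) (e i) = 1" using orthonormalD[OF e] by simp
    then show "1 - \<epsilon> \<le> (\<integral>w. (ip n (\<xi> w) (e i))\<^sup>2 - (ip n (\<xi> w) (e i))\<^sup>2 * indicator G w \<partial>D)"
      using unif_int[OF G tailG, of "e i"]
      by (subst Bochner_Integration.integral_diff) (auto simp: int_ind)
  qed
  also have "\<dots> = (\<integral>w. (\<Sum>i<n. (b i)\<^sup>2 * ((ip n (\<xi> w) (e i))\<^sup>2 - (ip n (\<xi> w) (e i))\<^sup>2 * indicator G w)) \<partial>D)"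
    by (subst Bochner_Integration.integral_sum) (simp_all add: int_ind)
  also have "\<dots> = (\<integral>w. s w * (1 - indicator G w) \<partial>D)"
    by (simp add: s_def sum_distrib_right right_diff_distrib mult.assoc sum_subtractf)
  also have "\<dots> \<le> (\<integral>w. (1 + \<tau>) * F w \<partial>D)"
  proof (rule integral_mono)
    have "integrable D (\<lambda>w. s w - s w * indicator G w)"
      by (intro Bochner_Integration.integrable_diff s_int integrable_real_mult_indicator G)
    then show "integrable D (\<lambda>w. s w * (1 - indicator G w))" by (simp add: algebra_simps)
    show "integrable D (\<lambda>w. (1 + \<tau>) * F w)" by (intro integrable_mult_right F_int)
    fix w assume w: "w \<in> space D"
    show "s w * (1 - indicator G w) \<le> (1 + \<tau>) * F w"
    proof (cases "w \<in> G")
      case True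
      then show ?thesis using F0[of w] \<tau> by simp
    next
      case False
      then have "q w \<le> \<tau>" using w by (simp add: G_def)
      then have "s w * (1 + q w) \<le> s w * (1 + \<tau>)" using s0 by (intro mult_left_mono) auto
      then show ?thesis using False q0[of w] by (simp add: F field_simps)
    qed
  qed
  also have "\<dots> = (1 + \<tau>) * (\<integral>w. F w \<partial>D)" by simp
  finally show "(1 - \<epsilon>) / (1 + \<tau>) * (\<Sum>i<n. (b i)\<^sup>2) \<le> (\<integral>w. F w \<partial>D)"
    using \<tau> by (simp add: field_simps)
qed

text \<open>Moving the barrier raises the potential by at most \<delta> tr B^2, with B the resolvent
  at the new barrier, and the expected loss is at least (1 - \<epsilon>) tr B^2 / (1 + \<tau>). In
  \<delta> one factor 1 + \<epsilon> pays for the fluctuation allowance in \<tau>, the other for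
  comparing tr B with the old potential.\<close>

lemma advancing_step:
  fixes L u :: real
  assumes A: "symm n A" and L: "1 \<le> \<epsilon> * L" "2 * R \<le> \<epsilon> * \<eta> * L" and e1: "2 * \<epsilon>\<^sub>1 \<le> \<epsilon> * \<eta>"
    and gap: "u + L + 1 \<le> eigval n A 0"
  defines "\<delta> \<equiv> (1 - \<epsilon>) / (1 + \<epsilon>)\<^sup>2 / (1 + Phi n A u)"
  shows "integrable D (\<lambda>w. Phi n (rank_one_add A (\<xi> w)) (u + \<delta>))"
    and "(\<integral>w. Phi n (rank_one_add A (\<xi> w)) (u + \<delta>) \<partial>D) \<le> Phi n A u"
    and "u + \<delta> < eigval n A 0"
proof -
  have "\<epsilon> * L \<le> 1 * L \<or> L \<le> 0" using \<epsilon> by (metis linear mult_right_mono less_imp_le)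
  then have L1: "1 \<le> L" using L(1) \<epsilon> mult_nonneg_nonpos[of \<epsilon> L] by auto
  define P where "P = Phi n A u"
  have P0: "0 \<le> P" unfolding P_def using L1 gap by (intro Phi_nonneg A) auto
  have "1 \<le> (1 + \<epsilon>)\<^sup>2" using \<epsilon> by (intro one_le_power) simp
  then have kap: "0 < (1 - \<epsilon>) / (1 + \<epsilon>)\<^sup>2" "(1 - \<epsilon>) / (1 + \<epsilon>)\<^sup>2 \<le> 1"
    using \<epsilon> by (auto simp: pos_divide_le_eq intro: order_trans[of _ 1])
  have "0 < x / (1 + P) \<and> x / (1 + P) \<le> 1" if "0 < x" "x \<le> 1" for x
    using that P0 by simp
  from this[OF kap] have \<delta>: "0 < \<delta>" "\<delta> \<le> 1"
    unfolding \<delta>_def P_def[symmetric] by auto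
  show u': "u + \<delta> < eigval n A 0" using \<delta> gap L1 by simp
  define b where "b = resolvent_eigval n A (u + \<delta>)"
  define t where "t = Phi n A (u + \<delta>)"
  \<comment> \<open>Since \<delta> is at most 1, the gap L + 1 before the move leaves a gap L after
    it.\<close>
  have far: "L \<le> eigval n A l - (u + \<delta>)" if "l < n" for l
    using eigval_0_le[OF A that] gap \<delta> by linarith
  have b: "0 < b l" "b l \<le> 1 / L" if "l < n" for l
    using far[OF that] L1 by (auto simp: b_def resolvent_eigval_def intro!: divide_left_mono)
  have anti: "b j \<le> b i" if "i \<le> j" "j < n" for i j
    using far[of i] far[of j] that L1 eigensystemD(3)[OF eigensystem_eigval[OF A] that]
    by (auto simp: b_def resolvent_eigval_def intro!: divide_left_mono)
  have t: "t = (\<Sum>l<n. b l)" by (simp add: t_def Phi_def b_def resolvent_eigval_def)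
  have t0: "0 \<le> t" unfolding t by (intro sum_nonneg) (auto intro: less_imp_le b)
  have "t \<le> (1 + \<epsilon>) * P"
    unfolding t P_def Phi_def sum_distrib_left
  proof (rule sum_mono)
    fix l assume "l \<in> {..<n}"
    then have l: "L \<le> eigval n A l - (u + \<delta>)" using far by simp
    \<comment> \<open>As \<delta> \<le> 1 \<le> \<epsilon> L, the move changes each distance to the
      spectrum by a relative amount of at most \<epsilon>.\<close>
    have "\<delta> \<le> \<epsilon> * (eigval n A l - (u + \<delta>))"
      using l L(1) \<delta> \<epsilon> mult_left_mono[OF l, of \<epsilon>] by linarith
    then show "b l \<le> (1 + \<epsilon>) * (1 / (eigval n A l - u))"
      using l L1 \<delta> by (simp add: b_def resolvent_eigval_def divide_simps algebra_simps)
  qed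
  then have tP: "1 + t \<le> (1 + \<epsilon>) * (1 + P)" using \<epsilon> by (simp add: algebra_simps)
  have shift: "t - P \<le> \<delta> * (\<Sum>l<n. (b l)\<^sup>2)"
    unfolding t P_def Phi_def sum_distrib_left sum_subtractf[symmetric]
  proof (rule sum_mono)
    fix l assume "l \<in> {..<n}"
    then have l: "L \<le> eigval n A l - (u + \<delta>)" using far by simp
    have "b l - 1 / (eigval n A l - u) = \<delta> * (b l * (1 / (eigval n A l - u)))"
      using l L1 \<delta> by (simp add: b_def resolvent_eigval_def field_simps)
    also have "\<dots> \<le> \<delta> * (b l * b l)"
      using l L1 \<delta> by (intro mult_left_mono) (auto simp: b_def resolvent_eigval_def divide_simps)
    finally show "b l - 1 / (eigval n A l - u) \<le> \<delta> * (b l)\<^sup>2" by (simp add: power2_eq_square)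
  qed
  define e where "e = eigvec n A"
  have e: "orthonormal n n e"
    unfolding e_def using eigensystemD(1)[OF eigensystem_eigval[OF A]] .
  define q where "q = (\<lambda>w. \<Sum>i<n. b i * (ip n (\<xi> w) (e i))\<^sup>2)"
  \<comment> \<open>The threshold exceeds the mean \<open>t\<close> of \<open>q\<close> by
    \<epsilon> (1 + t), which makes 1 + \<tau> factor as (1 + \<epsilon>)(1 + t).\<close>
  define \<tau> where "\<tau> = t + \<epsilon> * (1 + t)"
  have [measurable]: "q \<in> borel_measurable D" unfolding q_def by measurable
  have int_q: "integrable D q"
    unfolding q_def by (intro Bochner_Integration.integrable_sum integrable_mult_right integrable_second_moment)
  \<comment> \<open>Markov's inequality is applied to the positive part of q - t, whose mean is
    small by \<open>quadratic_excess\<close>; applied to q itself it would not give a small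
    probability.\<close>
  have "prob {w \<in> space D. \<tau> < q w} \<le> prob {w \<in> space D. \<epsilon> * (1 + t) \<le> max 0 (q w - t)}"
    by (intro finite_measure_mono) (auto simp: \<tau>_def)
  also have "\<dots> \<le> (\<integral>w. max 0 (q w - t) \<partial>D) / (\<epsilon> * (1 + t))"
    using int_q \<epsilon> t0 by (intro integral_Markov_inequality_measure[where A = "{}"]) auto
  also have "\<dots> \<le> (\<epsilon>\<^sub>1 * t + R * b 0) / (\<epsilon> * (1 + t))"
    using quadratic_excess[OF e, of b] b anti t0 \<epsilon> unfolding q_def t
    by (intro divide_right_mono) (auto intro: less_imp_le)
  also have "\<dots> \<le> \<eta>"
  proof -
    \<comment> \<open>The two error terms get half of \<epsilon> \<eta> each: L is large enough for
      the constant term, \<open>\<epsilon>\<^sub>1\<close> small enough for the linear one.\<close>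
    have "R * b 0 \<le> R * (1 / L)" using b(2)[of 0] n_pos R by (intro mult_left_mono) auto
    also have "\<dots> \<le> \<epsilon> * \<eta> / 2" using L(2) L1 by (simp add: field_simps)
    finally have "R * b 0 \<le> \<epsilon> * \<eta> / 2" .
    moreover have "2 * \<epsilon>\<^sub>1 * t \<le> \<epsilon> * \<eta> * t" using e1 t0 by (intro mult_right_mono)
    moreover have "0 \<le> \<epsilon> * \<eta> * t" using \<epsilon> \<eta> t0 by simp
    ultimately have "\<epsilon>\<^sub>1 * t + R * b 0 \<le> \<epsilon> * \<eta> * t + \<epsilon> * \<eta>"
      using \<epsilon> \<eta> mult_pos_pos[of \<epsilon> \<eta>] by linarith
    moreover have "0 < \<epsilon> * (1 + t)" using \<epsilon> t0 by simp
    ultimately show ?thesis by (simp only: pos_divide_le_eq) (simp add: algebra_simps)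
  qed
  finally have tail: "prob {w \<in> space D. \<tau> < q w} \<le> \<eta>" .
  define F where "F = (\<lambda>w. (\<Sum>i<n. (b i)\<^sup>2 * (ip n (\<xi> w) (e i))\<^sup>2) / (1 + (\<Sum>i<n. b i * (ip n (\<xi> w) (e i))\<^sup>2)))"
  have Phi: "Phi n (rank_one_add A (\<xi> w)) (u + \<delta>) = t - F w" for w
    using Phi_rank_one_add[OF A u' n_pos] by (simp add: F_def t_def b_def e_def)
  have \<tau>0: "0 \<le> \<tau>" using t0 \<epsilon> by (simp add: \<tau>_def)
  have "\<And>l. l < n \<Longrightarrow> 0 \<le> b l" using b(1) by (auto intro: less_imp_le)
  note loss = resolvent_loss[OF e this \<tau>0 tail[unfolded q_def], folded F_def]
  have F_int: "integrable D F" using loss(1) by simp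
  show "integrable D (\<lambda>w. Phi n (rank_one_add A (\<xi> w)) (u + \<delta>))"
    unfolding Phi using F_int by simp
  have "\<delta> = (1 - \<epsilon>) / ((1 + \<epsilon>) * ((1 + \<epsilon>) * (1 + P)))"
    by (simp add: \<delta>_def P_def power2_eq_square)
  also have "\<dots> \<le> (1 - \<epsilon>) / ((1 + \<epsilon>) * (1 + t))"
    using \<epsilon> t0 tP P0 by (intro divide_left_mono mult_left_mono mult_pos_pos) auto
  also have "(1 + \<epsilon>) * (1 + t) = 1 + \<tau>" by (simp add: \<tau>_def algebra_simps)
  finally have "\<delta> * (\<Sum>l<n. (b l)\<^sup>2) \<le> (1 - \<epsilon>) / (1 + \<tau>) * (\<Sum>l<n. (b l)\<^sup>2)"
    by (intro mult_right_mono sum_nonneg) auto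
  also have "\<dots> \<le> (\<integral>w. F w \<partial>D)" using loss(2) by simp
  finally have "t - (\<integral>w. F w \<partial>D) \<le> P" using shift by simp
  then show "(\<integral>w. Phi n (rank_one_add A (\<xi> w)) (u + \<delta>) \<partial>D) \<le> Phi n A u"
    unfolding Phi P_def[symmetric] using F_int by (simp add: prob_space)
qed

text \<open>With an eigenvalue close to the barrier the concentration bound is too weak, so the tail
  comes from plain Markov at t / \<eta>, where t is the mean of q. That nearby eigenvalue alone
  forces tr B^2 \<ge> 1 / (L + 1)^2, so the potential still drops by a definite amount.\<close>

lemma resting_step:
  fixes L u :: real
  assumes A: "symm n A" and L: "0 \<le> L" and u: "u < eigval n A 0" and gap: "eigval n A 0 \<le> u + L + 1"
  shows "integrable D (\<lambda>w. Phi n (rank_one_add A (\<xi> w)) u)"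
    and "(\<integral>w. Phi n (rank_one_add A (\<xi> w)) u \<partial>D) \<le> Phi n A u - (1 - \<epsilon>) / ((L + 1)\<^sup>2 * (1 + Phi n A u / \<eta>))"
proof -
  define b where "b = resolvent_eigval n A u"
  define t where "t = Phi n A u"
  have b: "0 < b l" if "l < n" for l
    using eigval_0_le[OF A that] u by (auto simp: b_def resolvent_eigval_def)
  have t: "t = (\<Sum>l<n. b l)" by (simp add: t_def Phi_def b_def resolvent_eigval_def)
  have t0: "0 < t" unfolding t using n_pos by (intro sum_pos) (auto intro: b simp: lessThan_empty_iff)
  define e where "e = eigvec n A"
  have e: "orthonormal n n e"
    unfolding e_def using eigensystemD(1)[OF eigensystem_eigval[OF A]] .
  define q where "q = (\<lambda>w. \<Sum>i<n. b i * (ip n (\<xi> w) (e i))\<^sup>2)"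
  have [measurable]: "q \<in> borel_measurable D" unfolding q_def by measurable
  have int_q: "integrable D q"
    unfolding q_def by (intro Bochner_Integration.integrable_sum integrable_mult_right integrable_second_moment)
  have q0: "0 \<le> q w" for w unfolding q_def by (intro sum_nonneg mult_nonneg_nonneg) (auto intro: less_imp_le b)
  have Eq: "(\<integral>w. q w \<partial>D) = t"
    unfolding q_def t by (subst Bochner_Integration.integral_sum) (simp_all add: orthonormalD[OF e])
  have "prob {w \<in> space D. t / \<eta> < q w} \<le> prob {w \<in> space D. t / \<eta> \<le> q w}"
    by (intro finite_measure_mono) auto
  also have "\<dots> \<le> (\<integral>w. q w \<partial>D) / (t / \<eta>)"
    using int_q \<eta> t0 q0 by (intro integral_Markov_inequality_measure[where A = "{}"]) auto
  also have "\<dots> = \<eta>" using t0 \<eta> by (simp add: Eq)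
  finally have tail: "prob {w \<in> space D. t / \<eta> < q w} \<le> \<eta>" .
  define F where "F = (\<lambda>w. (\<Sum>i<n. (b i)\<^sup>2 * (ip n (\<xi> w) (e i))\<^sup>2) / (1 + (\<Sum>i<n. b i * (ip n (\<xi> w) (e i))\<^sup>2)))"
  have Phi: "Phi n (rank_one_add A (\<xi> w)) u = t - F w" for w
    using Phi_rank_one_add[OF A u n_pos] by (simp add: F_def t_def b_def e_def)
  have \<tau>0: "0 \<le> t / \<eta>" using t0 \<eta> by simp
  have "\<And>l. l < n \<Longrightarrow> 0 \<le> b l" using b by (auto intro: less_imp_le)
  note loss = resolvent_loss[OF e this \<tau>0 tail[unfolded q_def], folded F_def]
  have F_int: "integrable D F" using loss(1) by simp
  show "integrable D (\<lambda>w. Phi n (rank_one_add A (\<xi> w)) u)"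
    unfolding Phi using F_int by simp
  have "1 / (L + 1) \<le> b 0"
    using u gap L by (simp add: b_def resolvent_eigval_def frac_le)
  then have "(1 / (L + 1))\<^sup>2 \<le> (b 0)\<^sup>2"
    using L by (intro power_mono) auto
  also have "\<dots> \<le> (\<Sum>l<n. (b l)\<^sup>2)"
    using n_pos by (intro member_le_sum) auto
  finally have "(1 - \<epsilon>) / (1 + t / \<eta>) * (1 / (L + 1))\<^sup>2 \<le> (1 - \<epsilon>) / (1 + t / \<eta>) * (\<Sum>l<n. (b l)\<^sup>2)"
    using \<epsilon> \<tau>0 by (intro mult_left_mono) auto
  also have "\<dots> \<le> (\<integral>w. F w \<partial>D)" using loss(2) by simp
  finally have "(1 - \<epsilon>) / ((L + 1)\<^sup>2 * (1 + t / \<eta>)) \<le> (\<integral>w. F w \<partial>D)"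
    by (simp add: power_divide mult.commute)
  then show "(\<integral>w. Phi n (rank_one_add A (\<xi> w)) u \<partial>D) \<le> Phi n A u - (1 - \<epsilon>) / ((L + 1)\<^sup>2 * (1 + Phi n A u / \<eta>))"
    unfolding Phi t_def[symmetric] using F_int by (simp add: prob_space)
qed

end

section \<open>Moving the barrier\<close>

lemma eigval_0_ge_iff:
  assumes A: "symm n A" and "n \<ge> 1"
  shows "t \<le> eigval n A 0 \<longleftrightarrow> (\<forall>v. t * ip n v v \<le> ip n v (mv n A v))"
proof
  assume t: "t \<le> eigval n A 0"
  show "\<forall>v. t * ip n v v \<le> ip n v (mv n A v)"
    using least_eigenvalue_le_quadratic_form[OF A eigensystem_eigval[OF A]] mult_right_mono[OF t ip_ge_0]
    by (blast intro: order_trans)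
next
  assume *: "\<forall>v. t * ip n v v \<le> ip n v (mv n A v)"
  have "ip n (eigvec n A 0) (eigvec n A 0) = 1"
    using \<open>n \<ge> 1\<close> by (simp add: orthonormalD[OF eigensystemD(1)[OF eigensystem_eigval[OF A]]])
  then show "t \<le> eigval n A 0"
    using *[rule_format, of "eigvec n A 0"] quadratic_form_least_eigenvector[OF eigensystem_eigval[OF A] \<open>n \<ge> 1\<close>]
    by simp
qed

text \<open>Eigensystems are obtained by choice, so measurability goes through the variational
  characterisation, with the test vectors restricted to a countable dense set.\<close>

lemma eigval_0_measurable:
  assumes n: "n \<ge> 1" and sym: "\<And>w. w \<in> space S \<Longrightarrow> symm n (B w)"
    and B: "\<And>i j. i < n \<Longrightarrow> j < n \<Longrightarrow> (\<lambda>w. B w i j) \<in> borel_measurable S"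
  shows "(\<lambda>w. eigval n (B w) 0) \<in> borel_measurable S"
proof -
  obtain C :: "(nat \<Rightarrow> real) set" where "countable C"
    and dense: "\<And>X. open X \<Longrightarrow> X \<noteq> {} \<Longrightarrow> \<exists>d\<in>C. d \<in> X"
    using countable_dense_exists by blast
  have iff: "(t \<le> eigval n (B w) 0) \<longleftrightarrow> (\<forall>v\<in>C. t * ip n v v \<le> ip n v (mv n (B w) v))" if w: "w \<in> space S" for w t
  proof
    show "\<forall>v\<in>C. t * ip n v v \<le> ip n v (mv n (B w) v)" if "t \<le> eigval n (B w) 0"
      using that eigval_0_ge_iff[OF sym[OF w] n] by blast
    assume *: "\<forall>v\<in>C. t * ip n v v \<le> ip n v (mv n (B w) v)"
    have cont: "continuous_on UNIV (\<lambda>v :: nat \<Rightarrow> real. v i)" for i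
      by (rule continuous_on_product_coordinates)
    \<comment> \<open>The violating vectors form an open set; a nonempty one would contain a point
      of \<open>C\<close>.\<close>
    have "open {v. ip n v (mv n (B w) v) < t * ip n v v}"
      unfolding ip_def mv_def by (intro open_Collect_less continuous_intros cont)
    then have "{v. ip n v (mv n (B w) v) < t * ip n v v} = {}"
      using dense[of "{v. ip n v (mv n (B w) v) < t * ip n v v}"] * by force
    then show "t \<le> eigval n (B w) 0"
      unfolding eigval_0_ge_iff[OF sym[OF w] n] by (auto simp: not_less)
  qed
  have "{w \<in> space S. t \<le> eigval n (B w) 0} \<in> sets S" for t
  proof -
    have "{w \<in> space S. \<forall>v\<in>C. t * ip n v v \<le> ip n v (mv n (B w) v)} \<in> sets S"
    proof (rule sets.sets_Collect_countable_All'[OF _ \<open>countable C\<close>])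
      fix v
      have [measurable]: "(\<lambda>w. ip n v (mv n (B w) v)) \<in> borel_measurable S"
        unfolding ip_def mv_def by (intro borel_measurable_sum borel_measurable_times borel_measurable_const B) auto
      show "{w \<in> space S. t * ip n v v \<le> ip n v (mv n (B w) v)} \<in> sets S" by measurable
    qed
    also have "{w \<in> space S. \<forall>v\<in>C. t * ip n v v \<le> ip n v (mv n (B w) v)} = {w \<in> space S. t \<le> eigval n (B w) 0}"
      using iff by blast
    finally show ?thesis .
  qed
  then show ?thesis by (simp add: borel_measurable_iff_ge)
qed

text \<open>The conversion to \<open>ennreal\<close> cuts negative values off at zero, which can
  only enlarge the integral. This lets barrier values of either sign enter iterated nonnegative
  integrals.\<close>

lemma ennreal_integral_le_nn_integral:
  assumes "integrable S F"
  shows "ennreal (\<integral>w. F w \<partial>S) \<le> (\<integral>\<^sup>+w. ennreal (F w) \<partial>S)"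
proof -
  have "(\<integral>w. F w \<partial>S) \<le> (\<integral>w. max 0 (F w) \<partial>S)"
    using assms by (intro integral_mono) auto
  then have "ennreal (\<integral>w. F w \<partial>S) \<le> ennreal (\<integral>w. max 0 (F w) \<partial>S)"
    by (rule ennreal_leI)
  also have "\<dots> = (\<integral>\<^sup>+w. ennreal (max 0 (F w)) \<partial>S)"
    using assms by (intro nn_integral_eq_integral[symmetric]) auto
  also have "\<dots> = (\<integral>\<^sup>+w. ennreal (F w) \<partial>S)"
    by (intro nn_integral_cong) (simp add: max_def ennreal_neg)
  finally show ?thesis .
qed

text \<open>The left side is the tangent at y of the convex function 1 / x. It replaces the advance
  1 / (1 + \<Phi>) by an affine function of the potential, through which expectations pass.\<close>

lemma tangent_inverse:
  fixes x y :: real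
  assumes "0 < x" "0 < y"
  shows "2 / y - x / y\<^sup>2 \<le> 1 / x"
proof -
  have "1 / x - (2 / y - x / y\<^sup>2) = (y - x)\<^sup>2 / (x * y\<^sup>2)"
    using assms by (simp add: field_simps power2_eq_square)
  also have "\<dots> \<ge> 0" using assms by simp
  finally show ?thesis by simp
qed

text \<open>The starting matrix is a parameter so that an induction can absorb the vectors into it
  one at a time.\<close>

definition gram_add :: "(nat \<Rightarrow> nat \<Rightarrow> real) \<Rightarrow> (nat \<Rightarrow> nat \<Rightarrow> real) \<Rightarrow> nat \<Rightarrow> nat \<Rightarrow> nat \<Rightarrow> real" where
  "gram_add A x k i j = A i j + (\<Sum>l\<in>{1..k}. x l i * x l j)"

lemma symm_gram_add: "symm n A \<Longrightarrow> symm n (gram_add A x k)"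
  by (simp add: symm_def gram_add_def mult.commute)

section \<open>The barrier argument over independent copies\<close>

context regular_vector
begin

sublocale copies: product_sigma_finite "\<lambda>_ :: nat. D"
  by (simp add: product_sigma_finite_def sigma_finite_measure_axioms)

lemma eigval_gram_add_measurable:
  assumes "symm n A"
  shows "(\<lambda>\<omega>. eigval n (gram_add A (\<lambda>l. \<xi> (\<omega> l)) k) 0) \<in> borel_measurable (\<Pi>\<^sub>M l\<in>{1..k}. D)"
proof (rule eigval_0_measurable[OF n_pos symm_gram_add[OF assms]])
  fix i j assume ij: "i < n" "j < n"
  have "(\<lambda>\<omega>. \<xi> (\<omega> l) i) \<in> borel_measurable (\<Pi>\<^sub>M l\<in>{1..k}. D)" if "l \<in> {1..k}" "i < n" for l i
    using measurable_compose[OF measurable_component_singleton[OF that(1)] meas[OF that(2)]] .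
  then show "(\<lambda>\<omega>. gram_add A (\<lambda>l. \<xi> (\<omega> l)) k i j) \<in> borel_measurable (\<Pi>\<^sub>M l\<in>{1..k}. D)"
    unfolding gram_add_def by (intro borel_measurable_add borel_measurable_const borel_measurable_sum borel_measurable_times)
      (use ij in auto)
qed

text \<open>When the barrier \<open>u\<close> is far below the spectrum it advances without increasing the expected
  potential; otherwise it rests, and the expected decrease of the potential, weighted by the constant
  \<open>K\<close>, pays for the missed step.\<close>

lemma barrier_step:
  fixes L u \<phi> :: real
  assumes A: "symm n A" and u: "u < eigval n A 0" and \<phi>: "0 \<le> \<phi>"
    and L: "1 \<le> \<epsilon> * L" "2 * R \<le> \<epsilon> * \<eta> * L" and e1: "2 * \<epsilon>\<^sub>1 \<le> \<epsilon> * \<eta>"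
  defines "\<kappa> \<equiv> (1 - \<epsilon>) / (1 + \<epsilon>)\<^sup>2"
  defines "K \<equiv> (L + 1)\<^sup>2 * \<kappa> / ((1 - \<epsilon>) * \<eta>)"
  defines "V \<equiv> \<lambda>k u p. u + \<kappa> * real k * (2 / (1 + \<phi>) - (1 + p) / (1 + \<phi>)\<^sup>2) - K * p"
  shows "\<exists>u'. u' < eigval n A 0 \<and> integrable D (\<lambda>w. V k u' (Phi n (rank_one_add A (\<xi> w)) u')) \<and>
    V (Suc k) u (Phi n A u) \<le> (\<integral>w. V k u' (Phi n (rank_one_add A (\<xi> w)) u') \<partial>D)"
proof -
  define P where "P = Phi n A u"
  have P0: "0 \<le> P" unfolding P_def by (rule Phi_nonneg[OF A u])
  have \<kappa>: "0 < \<kappa>" using \<epsilon> by (simp add: \<kappa>_def)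
  have L0: "0 \<le> L" using L(1) \<epsilon> mult_nonneg_nonpos[of \<epsilon> L] by (cases "0 \<le> L") auto
  have K0: "0 \<le> K" using \<kappa> \<epsilon> \<eta> by (simp add: K_def)
  define c where "c = \<kappa> * real k / (1 + \<phi>)\<^sup>2"
  have c0: "0 \<le> c" using \<kappa> by (simp add: c_def)
  have V: "V k u' p = u' + \<kappa> * real k * (2 / (1 + \<phi>)) - c - (c + K) * p" for u' p
    by (simp add: V_def c_def algebra_simps add_divide_distrib)
  have EV: "integrable D (\<lambda>w. V k u' (F w))" "(\<integral>w. V k u' (F w) \<partial>D) = V k u' (\<integral>w. F w \<partial>D)"
    if "integrable D F" for u' F
    using that unfolding V by (simp_all add: prob_space)
  \<comment> \<open>One more remaining vector is worth \<kappa> times the tangent of 1 / (1 + p) at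
    \<phi>, which \<open>gain\<close> bounds by the actual advance \<kappa> / (1 + P).\<close>
  have VSuc: "V (Suc k) u P = V k u P + \<kappa> * (2 / (1 + \<phi>) - (1 + P) / (1 + \<phi>)\<^sup>2)"
    unfolding V_def of_nat_Suc by (simp only: distrib_left distrib_right mult_1_right)
  have "\<kappa> * (2 / (1 + \<phi>) - (1 + P) / (1 + \<phi>)\<^sup>2) \<le> \<kappa> * (1 / (1 + P))"
    using tangent_inverse[of "1 + P" "1 + \<phi>"] P0 \<phi> \<kappa> by (intro mult_left_mono) auto
  then have gain: "\<kappa> * (2 / (1 + \<phi>) - (1 + P) / (1 + \<phi>)\<^sup>2) \<le> \<kappa> / (1 + P)"
    by simp
  show ?thesis
  proof (cases "u + L + 1 \<le> eigval n A 0")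
    case True
    define u' where "u' = u + \<kappa> / (1 + P)"
    note good = advancing_step[OF A L e1 True, folded \<kappa>_def P_def, folded u'_def]
    have "V (Suc k) u P \<le> V k u P + \<kappa> / (1 + P)" using gain VSuc by simp
    also have "\<dots> = V k u' P" by (simp add: V_def u'_def)
    also have "\<dots> \<le> V k u' (\<integral>w. Phi n (rank_one_add A (\<xi> w)) u' \<partial>D)"
      unfolding V using good(2) c0 K0 by (intro diff_left_mono mult_left_mono) auto
    finally show ?thesis
      using good(1,3) EV[OF good(1)] unfolding P_def[symmetric] by (intro exI[of _ u']) auto
  next
    case False
    then have gap: "eigval n A 0 \<le> u + L + 1" by simp
    define d where "d = (1 - \<epsilon>) / ((L + 1)\<^sup>2 * (1 + P / \<eta>))"
    note bad = resting_step[OF A L0 u gap, folded P_def, folded d_def]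
    have d0: "0 \<le> d" using \<epsilon> \<eta> P0 by (simp add: d_def)
    \<comment> \<open>\<open>K\<close> is chosen so that \<open>K * d\<close> equals \<kappa> /
      (\<eta> + P), and \<eta> \<le> 1 makes this cover the missed advance.\<close>
    have "\<kappa> / (1 + P) \<le> \<kappa> / (\<eta> + P)"
      using \<kappa> \<eta> P0 by (intro divide_left_mono mult_pos_pos) auto
    also have "\<dots> = K * d"
    proof -
      have "\<eta> * (1 + P / \<eta>) = \<eta> + P" using \<eta> by (simp add: field_simps)
      moreover have "K * d = \<kappa> / (\<eta> * (1 + P / \<eta>))"
        using \<epsilon> L0 by (simp add: K_def d_def)
      ultimately show ?thesis by simp
    qed
    finally have "V (Suc k) u P \<le> V k u P + K * d" using gain VSuc by simp
    also have "\<dots> \<le> V k u P + (c + K) * d" using c0 d0 by (simp add: mult_right_mono)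
    also have "\<dots> = V k u (P - d)" unfolding V by (simp add: algebra_simps)
    also have "\<dots> \<le> V k u (\<integral>w. Phi n (rank_one_add A (\<xi> w)) u \<partial>D)"
      unfolding V using bad(2) c0 K0 by (intro diff_left_mono mult_left_mono) auto
    finally show ?thesis
      using u EV[OF bad(1)] unfolding P_def[symmetric] by (intro exI[of _ u]) auto
  qed
qed

text \<open>\<open>V k u p\<close> estimates what a barrier at \<open>u\<close> with potential
  \<open>p\<close> attains with \<open>k\<close> vectors to come: its position, the linearised
  advances, minus the price \<open>K * p\<close> of all rests. The induction removes the first
  vector and keeps \<open>A\<close> and \<open>u\<close> general, since both change with it. Each
  new barrier is fixed before its vector is drawn, and later barriers stay inside the induction
  hypothesis, so no measurable choice of them arises.\<close>

lemma barrier_bound: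
  fixes L u \<phi> :: real
  assumes \<phi>: "0 \<le> \<phi>"
    and L: "1 \<le> \<epsilon> * L" "2 * R \<le> \<epsilon> * \<eta> * L" and e1: "2 * \<epsilon>\<^sub>1 \<le> \<epsilon> * \<eta>"
  defines "\<kappa> \<equiv> (1 - \<epsilon>) / (1 + \<epsilon>)\<^sup>2"
  defines "K \<equiv> (L + 1)\<^sup>2 * \<kappa> / ((1 - \<epsilon>) * \<eta>)"
  defines "V \<equiv> \<lambda>k u p. u + \<kappa> * real k * (2 / (1 + \<phi>) - (1 + p) / (1 + \<phi>)\<^sup>2) - K * p"
  shows "symm n A \<Longrightarrow> u < eigval n A 0 \<Longrightarrow> ennreal (V k u (Phi n A u)) \<le>
    (\<integral>\<^sup>+\<omega>. ennreal (eigval n (gram_add A (\<lambda>l. \<xi> (\<omega> l)) k) 0) \<partial>(\<Pi>\<^sub>M l\<in>{1..k}. D))"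
proof (induction k arbitrary: A u)
  case 0
  have "0 \<le> K" using \<epsilon> \<eta> by (simp add: K_def \<kappa>_def)
  then have "V 0 u (Phi n A u) \<le> eigval n A 0"
    using 0 mult_nonneg_nonneg[OF _ Phi_nonneg[OF 0], of K] by (simp add: V_def)
  then have "ennreal (V 0 u (Phi n A u)) \<le> ennreal (eigval n A 0)" by (rule ennreal_leI)
  moreover have "gram_add A x 0 = A" for x by (simp add: gram_add_def fun_eq_iff)
  then have "(\<integral>\<^sup>+\<omega>. ennreal (eigval n (gram_add A (\<lambda>l. \<xi> (\<omega> l)) 0) 0) \<partial>(\<Pi>\<^sub>M l\<in>{1..0}. D)) = ennreal (eigval n A 0)"
    by (simp add: space_PiM)
  ultimately show ?case by simp
next
  case (Suc k)
  obtain u' where u': "u' < eigval n A 0" "integrable D (\<lambda>w. V k u' (Phi n (rank_one_add A (\<xi> w)) u'))"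
    "V (Suc k) u (Phi n A u) \<le> (\<integral>w. V k u' (Phi n (rank_one_add A (\<xi> w)) u') \<partial>D)"
    using barrier_step[OF Suc.prems \<phi> L e1, of k] unfolding V_def K_def \<kappa>_def by blast
  have "ennreal (V (Suc k) u (Phi n A u)) \<le> ennreal (\<integral>w. V k u' (Phi n (rank_one_add A (\<xi> w)) u') \<partial>D)"
    by (rule ennreal_leI[OF u'(3)])
  also have "\<dots> \<le> (\<integral>\<^sup>+w. ennreal (V k u' (Phi n (rank_one_add A (\<xi> w)) u')) \<partial>D)"
    by (rule ennreal_integral_le_nn_integral[OF u'(2)])
  also have "\<dots> \<le> (\<integral>\<^sup>+w. (\<integral>\<^sup>+\<omega>. ennreal (eigval n (gram_add (rank_one_add A (\<xi> w)) (\<lambda>l. \<xi> (\<omega> l)) k) 0) \<partial>(\<Pi>\<^sub>M l\<in>{1..k}. D)) \<partial>D)"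
    using u'(1) eigval_0_rank_one_add[OF Suc.prems(1) n_pos]
    by (intro nn_integral_mono Suc.IH symm_rank_one_add Suc.prems(1)) (rule less_le_trans)
  \<comment> \<open>The vector absorbed first receives the last index \<open>Suc k\<close>. The Gram
    sum ignores the order, and the product integral can then be split at that index.\<close>
  also have "\<dots> = (\<integral>\<^sup>+w. (\<integral>\<^sup>+\<omega>. ennreal (eigval n (gram_add A (\<lambda>l. \<xi> ((fun_upd \<omega> (Suc k) w) l)) (Suc k)) 0) \<partial>(\<Pi>\<^sub>M l\<in>{1..k}. D)) \<partial>D)"
  proof -
    have "gram_add (rank_one_add A (\<xi> w)) (\<lambda>l. \<xi> (\<omega> l)) k = gram_add A (\<lambda>l. \<xi> ((fun_upd \<omega> (Suc k) w) l)) (Suc k)" for w \<omega>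
      by (simp add: gram_add_def rank_one_add_def fun_eq_iff)
    then show ?thesis by simp
  qed
  also have "\<dots> = (\<integral>\<^sup>+\<omega>. ennreal (eigval n (gram_add A (\<lambda>l. \<xi> (\<omega> l)) (Suc k)) 0) \<partial>(\<Pi>\<^sub>M l\<in>insert (Suc k) {1..k}. D))"
    using eigval_gram_add_measurable[OF Suc.prems(1), of "Suc k"]
    by (intro copies.product_nn_integral_insert_rev[symmetric]) (auto simp: atLeastAtMostSuc_conv)
  also have "insert (Suc k) {1..k} = {1..Suc k}" by auto
  finally show ?case .
qed

text \<open>The zero matrix with barrier -n / \<phi> has potential exactly \<phi>, the point of
  tangency, so the linearised gain per vector is exactly \<kappa> / (1 + \<phi>), where \<kappa> =
  (1 - \<epsilon>) / (1 + \<epsilon>)^2.\<close>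

lemma least_eigenvalue_lower_bound:
  fixes L \<phi> :: real
  assumes \<phi>: "0 < \<phi>"
    and L: "1 \<le> \<epsilon> * L" "2 * R \<le> \<epsilon> * \<eta> * L" and e1: "2 * \<epsilon>\<^sub>1 \<le> \<epsilon> * \<eta>"
  shows "ennreal ((1 - \<epsilon>) / (1 + \<epsilon>)\<^sup>2 * real k / (1 + \<phi>) - real n / \<phi> - (L + 1)\<^sup>2 / ((1 + \<epsilon>)\<^sup>2 * \<eta>) * \<phi>) \<le>
    (\<integral>\<^sup>+\<omega>. ennreal (eigval n (\<lambda>i j. \<Sum>l\<in>{1..k}. \<xi> (\<omega> l) i * \<xi> (\<omega> l) j) 0) \<partial>(\<Pi>\<^sub>M l\<in>{1..k}. D))"
proof -
  define Z :: "nat \<Rightarrow> nat \<Rightarrow> real" where "Z = (\<lambda>_ _. 0)"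
  define u where "u = - real n / \<phi>"
  have Z: "symm n Z" by (simp add: Z_def symm_def)
  have eigval: "eigval n Z l = 0" if "l < n" for l
  proof -
    have "ip n (\<lambda>i. eigval n Z l * eigvec n Z l i) (eigvec n Z l) = ip n (mv n Z (eigvec n Z l)) (eigvec n Z l)"
      using that by (intro ip_cong) (simp_all add: eigensystemD(2)[OF eigensystem_eigval[OF Z]])
    also have "\<dots> = 0" by (simp add: Z_def mv_def ip_def)
    finally show ?thesis
      using that by (simp add: ip_scale_left orthonormalD[OF eigensystemD(1)[OF eigensystem_eigval[OF Z]]])
  qed
  have u: "u < eigval n Z 0" using n_pos \<phi> by (simp add: eigval u_def)
  have Phi: "Phi n Z u = \<phi>"
    using n_pos \<phi> by (simp add: Phi_def eigval u_def)
  have "2 / (1 + \<phi>) - (1 + \<phi>) / (1 + \<phi>)\<^sup>2 = 1 / (1 + \<phi>)"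
    using \<phi> by (simp add: power2_eq_square flip: diff_divide_distrib)
  moreover have "gram_add Z x k = (\<lambda>i j. \<Sum>l\<in>{1..k}. x l i * x l j)" for x
    by (simp add: gram_add_def Z_def fun_eq_iff)
  moreover have "(L + 1)\<^sup>2 * ((1 - \<epsilon>) / (1 + \<epsilon>)\<^sup>2) / ((1 - \<epsilon>) * \<eta>) = (L + 1)\<^sup>2 / ((1 + \<epsilon>)\<^sup>2 * \<eta>)"
    using \<epsilon> by simp
  ultimately show ?thesis
    using barrier_bound[OF less_imp_le[OF \<phi>] L e1 Z u, of k, unfolded Phi] by (simp add: u_def)
qed

end

section \<open>Matrices and orthogonal projections\<close>

lemma mult_mat_vec_index:
  assumes "x \<in> carrier_vec n" "i < n"
  shows "(Matrix.mat n n (\<lambda>(i, j). A i j) *\<^sub>v x) $ i = mv n A (($) x) i"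
  using assms by (simp add: scalar_prod_def mv_def lessThan_atLeast0)

lemma scalar_prod_ip: "y \<in> carrier_vec n \<Longrightarrow> x \<bullet> y = ip n (($) x) (($) y)"
  by (simp add: scalar_prod_def ip_def lessThan_atLeast0)

text \<open>An eigenvector for a value outside the list would be orthogonal to the whole eigenbasis,
  hence zero by Parseval.\<close>

lemma spectrum_eq_eigval:
  assumes A: "symm n A"
  shows "spectrum (Matrix.mat n n (\<lambda>(i, j). A i j)) = eigval n A ` {..<n}" (is "spectrum ?B = _")
proof (intro equalityI subsetI)
  note e = eigensystem_eigval[OF A]
  fix k
  assume "k \<in> spectrum ?B"
  then obtain v where v: "v \<in> carrier_vec n" "v \<noteq> 0\<^sub>v n" "?B *\<^sub>v v = k \<cdot>\<^sub>v v"
    by (auto simp: spectrum_def eigenvalue_def eigenvector_def)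
  define w where "w = ($) v"
  have w: "mv n A w i = k * w i" if "i < n" for i
    using mult_mat_vec_index[OF v(1) that, of A] v(1) that by (simp add: v(3) w_def)
  show "k \<in> eigval n A ` {..<n}"
  proof (rule ccontr)
    assume no: "k \<notin> eigval n A ` {..<n}"
    have "ip n w (eigvec n A l) = 0" if l: "l < n" for l
    proof -
      have "eigval n A l * ip n w (eigvec n A l) = ip n (mv n A w) (eigvec n A l)"
        by (simp add: ip_eigenvector[OF A e l])
      also have "\<dots> = ip n (\<lambda>i. k * w i) (eigvec n A l)" by (rule ip_cong) (simp_all add: w)
      also have "\<dots> = k * ip n w (eigvec n A l)" by (rule ip_scale_left)
      finally show ?thesis using no l by auto
    qed
    then have "ip n w w = 0"
      using parseval[OF eigensystemD(1)[OF e], of w w] by simp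
    then have "v = 0\<^sub>v n"
      using v(1) by (intro eq_vecI) (auto simp: ip_eq_0_iff w_def)
    then show False using v(2) by simp
  qed
next
  note e = eigensystem_eigval[OF A]
  fix k
  assume "k \<in> eigval n A ` {..<n}"
  then obtain l where l: "l < n" and k: "k = eigval n A l" by auto
  define v where "v = Matrix.vec n (eigvec n A l)"
  have v: "v \<in> carrier_vec n" by (simp add: v_def)
  have "?B *\<^sub>v v = k \<cdot>\<^sub>v v"
  proof (rule eq_vecI)
    fix i assume "i < dim_vec (k \<cdot>\<^sub>v v)"
    then have i: "i < n" using v by simp
    have "(?B *\<^sub>v v) $ i = mv n A (($) v) i" by (rule mult_mat_vec_index[OF v i])
    also have "\<dots> = mv n A (eigvec n A l) i" by (simp add: mv_def v_def)
    also have "\<dots> = (k \<cdot>\<^sub>v v) $ i" using i l by (simp add: eigensystemD(2)[OF e] k v_def)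
    finally show "(?B *\<^sub>v v) $ i = (k \<cdot>\<^sub>v v) $ i" .
  qed (simp add: v_def)
  moreover have "v \<noteq> 0\<^sub>v n"
  proof
    assume "v = 0\<^sub>v n"
    then have "eigvec n A l i = 0" if "i < n" for i
      using that by (metis index_vec index_zero_vec(1) v_def)
    then have "ip n (eigvec n A l) (eigvec n A l) = 0" by (simp add: ip_eq_0_iff)
    then show False using l by (simp add: orthonormalD[OF eigensystemD(1)[OF e]])
  qed
  ultimately show "k \<in> spectrum ?B"
    using v by (auto simp: spectrum_def eigenvalue_def eigenvector_def intro!: exI[of _ v])
qed

lemma lambda_min_eq_eigval:
  assumes A: "symm n A" and n: "n \<ge> 1"
  shows "lambda_min (Matrix.mat n n (\<lambda>(i, j). A i j)) = eigval n A 0"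
  unfolding lambda_min_def spectrum_eq_eigval[OF A]
  using n eigval_0_le[OF A] by (intro Min_eqI) auto

lemma lambda_min_sum_outer_prod:
  assumes n: "n \<ge> 1" and x: "\<And>l. l \<in> {1..m} \<Longrightarrow> x l \<in> carrier_vec n"
  shows "lambda_min (sum_outer_prod n m x) = eigval n (\<lambda>i j. \<Sum>l\<in>{1..m}. x l $ i * x l $ j) 0"
proof -
  have "sum_outer_prod n m x = Matrix.mat n n (\<lambda>(i, j). \<Sum>l\<in>{1..m}. x l $ i * x l $ j)"
    unfolding sum_outer_prod_def
  proof (rule eq_matI)
    fix i j
    assume "i < dim_row (Matrix.mat n n (\<lambda>(i, j). \<Sum>l\<in>{1..m}. x l $ i * x l $ j))"
      and "j < dim_col (Matrix.mat n n (\<lambda>(i, j). \<Sum>l\<in>{1..m}. x l $ i * x l $ j))"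
    then have ij: "i < n" "j < n" by auto
    have "outer_prod (x l) (x l) $$ (i, j) = x l $ i * x l $ j" if "l \<in> {1..m}" for l
      using x[OF that] ij by (simp add: outer_prod_def)
    then show "Matrix.mat n n (\<lambda>(i, j). \<Sum>l\<in>{1..m}. outer_prod (x l) (x l) $$ (i, j)) $$ (i, j)
        = Matrix.mat n n (\<lambda>(i, j). \<Sum>l\<in>{1..m}. x l $ i * x l $ j) $$ (i, j)"
      using ij by simp
  qed auto
  then show ?thesis
    using lambda_min_eq_eigval[OF _ n, of "\<lambda>i j. \<Sum>l\<in>{1..m}. x l $ i * x l $ j"]
    by (simp add: symm_def mult.commute)
qed

section \<open>Projections onto spans of basis vectors and their ranks\<close>

definition proj_mat :: "nat \<Rightarrow> (nat \<Rightarrow> nat \<Rightarrow> real) \<Rightarrow> nat set \<Rightarrow> real Matrix.mat" where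
  "proj_mat n e S = Matrix.mat n n (\<lambda>(i, j). \<Sum>k\<in>S. e k i * e k j)"

lemma proj_mat_carrier [simp]: "proj_mat n e S \<in> carrier_mat n n"
  by (simp add: proj_mat_def)

lemma proj_mat_union:
  assumes "finite S" "finite T" "S \<inter> T = {}"
  shows "proj_mat n e (S \<union> T) = proj_mat n e S + proj_mat n e T"
  using assms by (intro eq_matI) (auto simp: proj_mat_def sum.union_disjoint)

lemma rank_proj_mat_le:
  assumes "finite S"
  shows "vec_space.rank n (proj_mat n e S) \<le> card S"
  using assms
proof (induction S)
  case empty
  interpret vec_space "TYPE(real)" n .
  have "proj_mat n e {} = 0\<^sub>m n n" by (intro eq_matI) (auto simp: proj_mat_def)
  then show ?case using rank_0I[of n] by simp
next
  case (insert k S)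
  interpret vec_space "TYPE(real)" n .
  have "proj_mat n e (insert k S) = proj_mat n e {k} + proj_mat n e S"
    using proj_mat_union[of "{k}" S n e] insert by simp
  then have "rank (proj_mat n e (insert k S)) \<le> rank (proj_mat n e {k}) + rank (proj_mat n e S)"
    using rank_subadditive[OF proj_mat_carrier proj_mat_carrier] by simp
  moreover have "rank (proj_mat n e {k}) \<le> 1"
    by (rule rank_le_1_product_entries[of _ n "e k" "e k"]) (auto simp: proj_mat_def)
  ultimately show ?case using insert by simp
qed

text \<open>The blocks for the first \<open>r\<close> and the remaining vectors have ranks at most r
  and n - r. They add up to the identity, so subadditivity of the rank forces equality in both
  bounds.\<close>

lemma rank_proj_mat:
  assumes e: "orthonormal n n e" and "r \<le> n"
  shows "vec_space.rank n (proj_mat n e {..<r}) = r"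
proof -
  interpret vec_space "TYPE(real)" n .
  have "proj_mat n e {..<n} = 1\<^sub>m n"
    by (intro eq_matI) (auto simp: proj_mat_def orthonormal_complete[OF e])
  then have "rank (proj_mat n e {..<n}) = n"
    using det_rank_iff[of "1\<^sub>m n"] by simp
  moreover have "proj_mat n e {..<n} = proj_mat n e {..<r} + proj_mat n e {r..<n}"
    using proj_mat_union[of "{..<r}" "{r..<n}" n e] \<open>r \<le> n\<close> by (simp add: ivl_disj_un ivl_disj_int)
  ultimately have "n \<le> rank (proj_mat n e {..<r}) + rank (proj_mat n e {r..<n})"
    using rank_subadditive[OF proj_mat_carrier proj_mat_carrier, of e "{..<r}" e "{r..<n}"] by simp
  then show ?thesis
    using rank_proj_mat_le[of "{..<r}" n e] rank_proj_mat_le[of "{r..<n}" n e] \<open>r \<le> n\<close> by simp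
qed

lemma orthogonal_projection_proj_mat:
  assumes e: "orthonormal n n e" and "r \<le> n"
  shows "orthogonal_projection n (proj_mat n e {..<r})"
proof -
  have "proj_mat n e {..<r} * proj_mat n e {..<r} = proj_mat n e {..<r}"
  proof (rule eq_matI)
    fix i j assume "i < dim_row (proj_mat n e {..<r})" "j < dim_col (proj_mat n e {..<r})"
    then have ij: "i < n" "j < n" by (auto simp: proj_mat_def)
    have "(proj_mat n e {..<r} * proj_mat n e {..<r}) $$ (i, j)
        = (\<Sum>l<n. (\<Sum>k<r. e k i * e k l) * (\<Sum>k<r. e k j * e k l))"
      using ij by (simp add: proj_mat_def scalar_prod_def lessThan_atLeast0 mult.commute)
    also have "\<dots> = ip n (\<lambda>l. \<Sum>k<r. e k i * e k l) (\<lambda>l. \<Sum>k<r. e k j * e k l)"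
      by (simp add: ip_def)
    also have "\<dots> = (\<Sum>k<r. e k i * (\<Sum>k'<r. e k' j * ip n (e k) (e k')))"
      by (simp add: ip_sum_left ip_sum_right)
    also have "\<dots> = (\<Sum>k<r. e k i * (\<Sum>k'<r. if k = k' then e k' j else 0))"
      using \<open>r \<le> n\<close> by (intro sum.cong refl arg_cong2[of _ _ _ _ "(*)"]) (auto simp: orthonormalD[OF e])
    also have "\<dots> = (\<Sum>k<r. e k i * e k j)" by simp
    finally show "(proj_mat n e {..<r} * proj_mat n e {..<r}) $$ (i, j) = proj_mat n e {..<r} $$ (i, j)"
      using ij by (simp add: proj_mat_def)
  qed (auto simp: proj_mat_def)
  moreover have "transpose_mat (proj_mat n e {..<r}) = proj_mat n e {..<r}"
    by (rule eq_matI) (auto simp: proj_mat_def mult.commute)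
  ultimately show ?thesis by (simp add: orthogonal_projection_def)
qed

text \<open>This matches the squared norms in condition (b) with the partial sums over leading basis
  vectors used in \<open>proj_conc\<close>.\<close>

lemma norm_proj_mat:
  assumes e: "orthonormal n n e" and "r \<le> n" and x: "x \<in> carrier_vec n"
  shows "(euclid_norm (proj_mat n e {..<r} *\<^sub>v x))\<^sup>2 = (\<Sum>k<r. (ip n (($) x) (e k))\<^sup>2)"
proof -
  define y where "y = proj_mat n e {..<r} *\<^sub>v x"
  have y: "y \<in> carrier_vec n" unfolding y_def by (rule mult_mat_vec_carrier[OF proj_mat_carrier x])
  have yi: "y $ i = (\<Sum>k<r. ip n (($) x) (e k) * e k i)" if "i < n" for i
  proof -
    have "y $ i = (\<Sum>j<n. \<Sum>k<r. e k i * e k j * x $ j)"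
      using mult_mat_vec_index[OF x that, of "\<lambda>i j. \<Sum>k<r. e k i * e k j"]
      by (simp add: y_def proj_mat_def mv_def sum_distrib_right)
    also have "\<dots> = (\<Sum>k<r. \<Sum>j<n. e k i * e k j * x $ j)"
      by (rule sum.swap)
    also have "\<dots> = (\<Sum>k<r. ip n (($) x) (e k) * e k i)"
      unfolding ip_def sum_distrib_right by (intro sum.cong refl) (simp add: mult_ac)
    finally show ?thesis .
  qed
  have "(euclid_norm y)\<^sup>2 = ip n (($) y) (($) y)"
    by (simp add: euclid_norm_def scalar_prod_ip[OF y])
  also have "\<dots> = ip n (\<lambda>i. \<Sum>k<r. ip n (($) x) (e k) * e k i) (\<lambda>i. \<Sum>k<r. ip n (($) x) (e k) * e k i)"
    by (rule ip_cong) (simp_all add: yi)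
  also have "\<dots> = (\<Sum>k<r. ip n (($) x) (e k) * (\<Sum>k'<r. ip n (($) x) (e k') * ip n (e k) (e k')))"
    by (simp add: ip_sum_left ip_sum_right)
  also have "\<dots> = (\<Sum>k<r. ip n (($) x) (e k) * (\<Sum>k'<r. if k = k' then ip n (($) x) (e k') else 0))"
    using \<open>r \<le> n\<close> by (intro sum.cong refl arg_cong2[of _ _ _ _ "(*)"]) (auto simp: orthonormalD[OF e])
  also have "\<dots> = (\<Sum>k<r. (ip n (($) x) (e k))\<^sup>2)" by (simp add: power2_eq_square)
  finally show ?thesis by (simp add: y_def)
qed

section \<open>Regularity of the distribution and the asymptotics of the edge\<close>

context isotropic_vector
begin

text \<open>On \<open>G\<close> the square is either at least \<open>K\<close>, and then counted in
  the tail, or below \<open>K\<close>, and then contributes at most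
  \<open>K * prob G\<close>.\<close>

lemma truncated_second_moment:
  assumes K: "0 \<le> K" and G: "G \<in> sets D"
    and c: "(\<integral>w. (ip n (\<xi> w) y)\<^sup>2 * indicator {w. K \<le> (ip n (\<xi> w) y)\<^sup>2} w \<partial>D) \<le> c"
  shows "(\<integral>w. (ip n (\<xi> w) y)\<^sup>2 * indicator G w \<partial>D) \<le> c + K * prob G"
proof -
  define H where "H = {w \<in> space D. K \<le> (ip n (\<xi> w) y)\<^sup>2}"
  have H: "H \<in> sets D" unfolding H_def by measurable
  have int_H: "integrable D (\<lambda>w. (ip n (\<xi> w) y)\<^sup>2 * indicator H w)"
    by (intro integrable_real_mult_indicator H integrable_second_moment)
  have int_G: "integrable D (\<lambda>w. K * indicator G w)"
    using G by (intro integrable_mult_right) (auto simp: less_top[symmetric])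
  have "(\<integral>w. (ip n (\<xi> w) y)\<^sup>2 * indicator G w \<partial>D)
      \<le> (\<integral>w. (ip n (\<xi> w) y)\<^sup>2 * indicator H w + K * indicator G w \<partial>D)"
  proof (rule integral_mono)
    show "integrable D (\<lambda>w. (ip n (\<xi> w) y)\<^sup>2 * indicator G w)"
      by (intro integrable_real_mult_indicator G integrable_second_moment)
    show "integrable D (\<lambda>w. (ip n (\<xi> w) y)\<^sup>2 * indicator H w + K * indicator G w)"
      using int_H int_G by simp
    show "(ip n (\<xi> w) y)\<^sup>2 * indicator G w \<le> (ip n (\<xi> w) y)\<^sup>2 * indicator H w + K * indicator G w"
      if "w \<in> space D" for w
      using that K by (auto simp: H_def indicator_def)
  qed
  also have "\<dots> = (\<integral>w. (ip n (\<xi> w) y)\<^sup>2 * indicator H w \<partial>D) + K * prob G"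
    using int_H int_G G by (subst Bochner_Integration.integral_add) simp_all
  also have "(\<integral>w. (ip n (\<xi> w) y)\<^sup>2 * indicator H w \<partial>D) =
      (\<integral>w. (ip n (\<xi> w) y)\<^sup>2 * indicator {w. K \<le> (ip n (\<xi> w) y)\<^sup>2} w \<partial>D)"
    by (intro Bochner_Integration.integral_cong) (auto simp: H_def indicator_def)
  finally show ?thesis using c by simp
qed

text \<open>The excess is at most the squared norm itself, which has mean r. This crude bound serves
  the ranks too small for condition (b) to say anything.\<close>

lemma projection_excess_le:
  assumes e: "orthonormal n n e" and r: "r \<le> n"
  shows "(\<integral>w. max 0 ((\<Sum>i<r. (ip n (\<xi> w) (e i))\<^sup>2) - real r) \<partial>D) \<le> real r"
proof -
  have "(\<integral>w. max 0 ((\<Sum>i<r. (ip n (\<xi> w) (e i))\<^sup>2) - real r) \<partial>D) \<le> (\<integral>w. (\<Sum>i<r. (ip n (\<xi> w) (e i))\<^sup>2) \<partial>D)"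
    by (intro integral_mono integrable_max integrable_const Bochner_Integration.integrable_diff
        Bochner_Integration.integrable_sum integrable_second_moment) (auto intro: sum_nonneg)
  also have "\<dots> = (\<Sum>i<r. 1)"
    using r by (subst Bochner_Integration.integral_sum) (simp_all add: orthonormalD[OF e])
  finally show ?thesis by simp
qed

text \<open>Off \<open>G\<close> the excess is below \<open>t * r\<close>. On \<open>G\<close> it is
  at most the sum of r squared coordinates, each with small mass there by uniform
  integrability.\<close>

lemma projection_excess_le_tail:
  assumes e: "orthonormal n n e" and r: "r \<le> n" and t: "0 \<le> t"
  defines "G \<equiv> {w \<in> space D. t * real r \<le> (\<Sum>i<r. (ip n (\<xi> w) (e i))\<^sup>2) - real r}"
  assumes c: "\<And>y. ip n y y = 1 \<Longrightarrow> (\<integral>w. (ip n (\<xi> w) y)\<^sup>2 * indicator G w \<partial>D) \<le> c"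
  shows "(\<integral>w. max 0 ((\<Sum>i<r. (ip n (\<xi> w) (e i))\<^sup>2) - real r) \<partial>D) \<le> (t + c) * real r"
proof -
  define S where "S = (\<lambda>w. \<Sum>i<r. (ip n (\<xi> w) (e i))\<^sup>2)"
  have G: "G \<in> sets D" unfolding G_def by measurable
  have S: "integrable D S"
    unfolding S_def by (intro Bochner_Integration.integrable_sum integrable_second_moment)
  have S0: "0 \<le> S w" for w by (simp add: S_def sum_nonneg)
  have SG: "integrable D (\<lambda>w. S w * indicator G w)"
    by (intro integrable_real_mult_indicator G S)
  have "(\<integral>w. max 0 (S w - real r) \<partial>D) \<le> (\<integral>w. t * real r + S w * indicator G w \<partial>D)"
  proof (rule integral_mono)
    show "integrable D (\<lambda>w. max 0 (S w - real r))" using S by simp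
    show "integrable D (\<lambda>w. t * real r + S w * indicator G w)" using SG by simp
    show "max 0 (S w - real r) \<le> t * real r + S w * indicator G w" if "w \<in> space D" for w
    proof -
      have "G = {w \<in> space D. t * real r \<le> S w - real r}" by (simp add: G_def S_def)
      then show ?thesis
        using that t S0[of w] by (cases "t * real r \<le> S w - real r") (auto simp: add_increasing)
    qed
  qed
  also have "\<dots> = t * real r + (\<integral>w. S w * indicator G w \<partial>D)"
    using SG by (simp add: prob_space)
  also have "(\<integral>w. S w * indicator G w \<partial>D) = (\<Sum>i<r. \<integral>w. (ip n (\<xi> w) (e i))\<^sup>2 * indicator G w \<partial>D)"
    unfolding S_def sum_distrib_right
    by (intro Bochner_Integration.integral_sum integrable_real_mult_indicator G integrable_second_moment)
  also have "\<dots> \<le> (\<Sum>i<r. c)"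
    using r by (intro sum_mono c) (simp add: orthonormalD[OF e])
  finally show ?thesis by (simp add: S_def algebra_simps)
qed

end

text \<open>Condition (a) is used twice: at level \<epsilon> it yields \<eta>, and at a level
  depending on \<eta> it yields \<open>\<eta>'\<close>. Beyond a rank \<open>R\<close> condition (b)
  makes the exceptional probability less than \<open>\<eta>'\<close>; up to \<open>R\<close> the
  crude bound is absorbed in the constant. All constants are independent of n.\<close>

lemma regular_vectors:
  fixes D :: "nat \<Rightarrow> 'd measure" and \<xi> :: "nat \<Rightarrow> 'd \<Rightarrow> nat \<Rightarrow> real" and f g :: "nat \<Rightarrow> real"
  assumes iso: "\<And>n. n \<ge> 1 \<Longrightarrow> isotropic_vector (D n) n (\<xi> n)"
    and a: "\<And>c. 0 < c \<Longrightarrow> \<exists>K\<ge>0. \<forall>n\<ge>1. \<forall>y. ip n y y = 1 \<longrightarrow>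
      (\<integral>w. (ip n (\<xi> n w) y)\<^sup>2 * indicator {w. K \<le> (ip n (\<xi> n w) y)\<^sup>2} w \<partial>D n) \<le> c"
    and f0: "\<And>r. r \<ge> 1 \<Longrightarrow> 0 \<le> f r" and f: "f \<longlonglongrightarrow> 0" and g: "g \<longlonglongrightarrow> 0"
    and b: "\<And>n e r. n \<ge> 1 \<Longrightarrow> 1 \<le> r \<Longrightarrow> r \<le> n \<Longrightarrow> orthonormal n n e \<Longrightarrow>
      measure (D n) {w \<in> space (D n). f r * real r \<le> (\<Sum>i<r. (ip n (\<xi> n w) (e i))\<^sup>2) - real r} \<le> g r"
    and \<epsilon>: "0 < \<epsilon>" "\<epsilon> < 1"
  shows "\<exists>\<eta> R. 0 < \<eta> \<and> 0 \<le> R \<and> (\<forall>n\<ge>1. regular_vector (D n) n (\<xi> n) \<epsilon> \<eta> R (\<epsilon> * \<eta> / 2))"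
proof -
  have unif: "\<exists>\<eta>. 0 < \<eta> \<and> \<eta> \<le> 1 \<and> (\<forall>n\<ge>1. \<forall>G\<in>sets (D n). \<forall>y. measure (D n) G \<le> \<eta> \<longrightarrow> ip n y y = 1 \<longrightarrow>
      (\<integral>w. (ip n (\<xi> n w) y)\<^sup>2 * indicator G w \<partial>D n) \<le> c)" if c: "0 < c" for c
  proof -
    obtain K where K: "0 \<le> K" and tr: "\<And>n y. n \<ge> 1 \<Longrightarrow> ip n y y = 1 \<Longrightarrow>
      (\<integral>w. (ip n (\<xi> n w) y)\<^sup>2 * indicator {w. K \<le> (ip n (\<xi> n w) y)\<^sup>2} w \<partial>D n) \<le> c / 2"
      using a[of "c / 2"] c by auto
    \<comment> \<open>This makes K \<eta> at most c / 2, the half left over by the truncated tail; K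
      + 1 guards against division by zero.\<close>
    define \<eta> where "\<eta> = min 1 (c / (2 * (K + 1)))"
    have \<eta>: "0 < \<eta>" "\<eta> \<le> 1" using c K by (auto simp: \<eta>_def)
    have "K * \<eta> \<le> (K + 1) * (c / (2 * (K + 1)))"
      using K c \<eta> by (intro mult_mono) (auto simp: \<eta>_def)
    also have "\<dots> = c / 2" using K by (simp add: field_simps)
    finally have K\<eta>: "K * \<eta> \<le> c / 2" .
    have "(\<integral>w. (ip n (\<xi> n w) y)\<^sup>2 * indicator G w \<partial>D n) \<le> c"
      if "n \<ge> 1" "G \<in> sets (D n)" "measure (D n) G \<le> \<eta>" "ip n y y = 1" for n G y
    proof -
      have "(\<integral>w. (ip n (\<xi> n w) y)\<^sup>2 * indicator G w \<partial>D n) \<le> c / 2 + K * measure (D n) G"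
        using isotropic_vector.truncated_second_moment[OF iso[OF that(1)] K that(2) tr[OF that(1,4)]] .
      moreover have "K * measure (D n) G \<le> K * \<eta>" using K that(3) by (intro mult_left_mono)
      ultimately show ?thesis using K\<eta> by simp
    qed
    then show ?thesis using \<eta> by blast
  qed
  obtain \<eta> where \<eta>: "0 < \<eta>" "\<eta> \<le> 1" and ui: "\<And>n G y. n \<ge> 1 \<Longrightarrow> G \<in> sets (D n) \<Longrightarrow> measure (D n) G \<le> \<eta> \<Longrightarrow>
      ip n y y = 1 \<Longrightarrow> (\<integral>w. (ip n (\<xi> n w) y)\<^sup>2 * indicator G w \<partial>D n) \<le> \<epsilon>"
    using unif[OF \<epsilon>(1)] by blast
  \<comment> \<open>The slope \<epsilon> \<eta> / 2 is split evenly between the deviation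
    \<open>f r\<close> and the mass on the exceptional event.\<close>
  define c where "c = \<epsilon> * \<eta> / 4"
  have c: "0 < c" using \<epsilon> \<eta> by (simp add: c_def)
  obtain \<eta>' where \<eta>': "0 < \<eta>'" and ui': "\<And>n G y. n \<ge> 1 \<Longrightarrow> G \<in> sets (D n) \<Longrightarrow> measure (D n) G \<le> \<eta>' \<Longrightarrow>
      ip n y y = 1 \<Longrightarrow> (\<integral>w. (ip n (\<xi> n w) y)\<^sup>2 * indicator G w \<partial>D n) \<le> c"
    using unif[OF c] by blast
  have "eventually (\<lambda>r. f r < c \<and> g r < \<eta>') sequentially"
    using order_tendstoD(2)[OF f c] order_tendstoD(2)[OF g \<eta>'] by eventually_elim auto
  then obtain R where R: "\<And>r. r \<ge> R \<Longrightarrow> f r < c \<and> g r < \<eta>'"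
    by (auto simp: eventually_sequentially)
  have "regular_vector (D n) n (\<xi> n) \<epsilon> \<eta> (real R) (\<epsilon> * \<eta> / 2)" if n: "n \<ge> 1" for n
  proof -
    interpret isotropic_vector "D n" n "\<xi> n" by (rule iso[OF n])
    show ?thesis
    proof
      fix e r
      assume e: "orthonormal n n e" and r: "r \<le> n"
      define I where "I = (\<integral>w. max 0 ((\<Sum>i<r. (ip n (\<xi> n w) (e i))\<^sup>2) - real r) \<partial>D n)"
      have nn: "0 \<le> \<epsilon> * \<eta> / 2 * real r" using \<epsilon> \<eta> by simp
      have "I \<le> \<epsilon> * \<eta> / 2 * real r + real R"
      proof (cases "r \<le> R")
        case True
        have "I \<le> real r" unfolding I_def by (rule projection_excess_le[OF e r])
        then show ?thesis using True nn by simp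
      next
        case False
        then have r1: "1 \<le> r" and fg: "f r < c" "g r < \<eta>'" using R[of r] by auto
        define G where "G = {w \<in> space (D n). f r * real r \<le> (\<Sum>i<r. (ip n (\<xi> n w) (e i))\<^sup>2) - real r}"
        have G: "G \<in> sets (D n)" unfolding G_def by measurable
        have pG: "measure (D n) G \<le> \<eta>'" using b[OF n r1 r e] fg(2) unfolding G_def by simp
        have "I \<le> (f r + c) * real r"
          unfolding I_def
          by (rule projection_excess_le_tail[OF e r f0[OF r1]]) (rule ui'[OF n G pG, unfolded G_def])
        also have "\<dots> \<le> (2 * c) * real r" using fg(1) by (intro mult_right_mono) auto
        also have "2 * c = \<epsilon> * \<eta> / 2" by (simp add: c_def)
        finally show ?thesis by simp
      qed
      then show "(\<integral>w. max 0 ((\<Sum>i<r. (ip n (\<xi> n w) (e i))\<^sup>2) - real r) \<partial>D n) \<le> \<epsilon> * \<eta> / 2 * real r + real R"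
        by (simp add: I_def)
    qed (use n \<epsilon> \<eta> ui in auto)
  qed
  then show ?thesis using \<eta>(1) by (intro exI[of _ \<eta>] exI[of _ "real R"]) simp
qed

section \<open>From random vectors to their laws and to the product measure\<close>

lemma space_borel_vec [simp]: "space (borel_vec n) = carrier_vec n"
  by (simp add: borel_vec_def)

lemma vec_index_measurable [measurable]:
  assumes "i < n"
  shows "(\<lambda>v. v $ i) \<in> borel_measurable (borel_vec n)"
proof -
  have "(\<lambda>v. \<lambda>i\<in>{..<n}. v $ i) \<in> measurable (borel_vec n) (\<Pi>\<^sub>M i\<in>{..<n}. borel)"
    unfolding borel_vec_def by (rule measurable_vimage_algebra1) (auto simp: space_PiM)
  from measurable_compose[OF this measurable_component_singleton[of i]]
  show ?thesis using assms by simp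
qed

lemma isotropic_vector_distr:
  assumes M: "prob_space M" and X: "random_vector M n X"
    and cov: "has_mat_expectation M (\<lambda>\<omega>. outer_prod (X \<omega>) (X \<omega>)) (1\<^sub>m n)"
  shows "isotropic_vector (distr M (borel_vec n) X) n ($)"
proof -
  interpret M: prob_space M by (rule M)
  interpret D: prob_space "distr M (borel_vec n) X" by (rule M.prob_space_distr[OF X])
  show ?thesis
  proof
    fix i j assume ij: "i < n" "j < n"
    have "has_bochner_integral M (\<lambda>\<omega>. outer_prod (X \<omega>) (X \<omega>) $$ (i, j)) (if i = j then 1 else 0)"
      using cov ij by (auto simp: has_mat_expectation_def)
    moreover have "outer_prod (X \<omega>) (X \<omega>) $$ (i, j) = X \<omega> $ i * X \<omega> $ j" if "\<omega> \<in> space M" for \<omega>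
      using measurable_space[OF X that] ij by (simp add: outer_prod_def)
    ultimately have "has_bochner_integral M (\<lambda>\<omega>. X \<omega> $ i * X \<omega> $ j) (if i = j then 1 else 0)"
      by (simp cong: has_bochner_integral_cong)
    then show "has_bochner_integral (distr M (borel_vec n) X) (\<lambda>v. v $ i * v $ j) (if i = j then 1 else 0)"
      using X ij by (intro has_bochner_integral_distr) measurable
  next
    show "(\<lambda>v. v $ i) \<in> borel_measurable (distr M (borel_vec n) X)" if "i < n" for i
      using vec_index_measurable[OF that] by simp
  qed
qed

lemma eigval_0_gram_nonneg:
  assumes "n \<ge> 1"
  shows "0 \<le> eigval n (\<lambda>i j. \<Sum>l\<in>S. x l i * x l j) 0"
proof -
  have "0 * ip n v v \<le> ip n v (mv n (\<lambda>i j. \<Sum>l\<in>S. x l i * x l j) v)" for v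
  proof -
    have "mv n (\<lambda>i j. \<Sum>l\<in>S. x l i * x l j) v = (\<lambda>i. \<Sum>l\<in>S. ip n (x l) v * x l i)"
    proof
      fix i
      have "mv n (\<lambda>i j. \<Sum>l\<in>S. x l i * x l j) v i = (\<Sum>j<n. \<Sum>l\<in>S. x l i * x l j * v j)"
        by (simp add: mv_def sum_distrib_right)
      also have "\<dots> = (\<Sum>l\<in>S. \<Sum>j<n. x l i * x l j * v j)" by (rule sum.swap)
      also have "\<dots> = (\<Sum>l\<in>S. ip n (x l) v * x l i)"
        unfolding ip_def sum_distrib_right by (intro sum.cong refl) (simp add: mult_ac)
      finally show "mv n (\<lambda>i j. \<Sum>l\<in>S. x l i * x l j) v i = (\<Sum>l\<in>S. ip n (x l) v * x l i)" .
    qed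
    then have "ip n v (mv n (\<lambda>i j. \<Sum>l\<in>S. x l i * x l j) v) = (\<Sum>l\<in>S. ip n (x l) v * ip n (x l) v)"
      by (simp add: ip_sum_right ip_commute)
    then show ?thesis by (simp add: sum_nonneg)
  qed
  then show ?thesis
    using eigval_0_ge_iff[of n "\<lambda>i j. \<Sum>l\<in>S. x l i * x l j" 0] assms by (simp add: symm_def mult.commute)
qed

text \<open>Testing the form at the first axis gives a majorant which, for a Gram matrix, is a sum
  of squared coordinates and hence integrable.\<close>

lemma eigval_0_le_diagonal:
  assumes A: "symm n A" and "n \<ge> 1"
  shows "eigval n A 0 \<le> A 0 0"
proof -
  define v :: "nat \<Rightarrow> real" where "v = (\<lambda>i. if i = 0 then 1 else 0)"
  have v: "ip n v y = y 0" for y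
    using ip_axis[of 0 n y] \<open>n \<ge> 1\<close> by (simp add: v_def)
  have "mv n A v 0 = ip n v (A 0)" by (simp add: mv_def ip_def mult.commute)
  then show ?thesis
    using least_eigenvalue_le_quadratic_form[OF A eigensystem_eigval[OF A], of v] by (simp add: v) (simp add: v_def)
qed

text \<open>Independence identifies the joint law of the copies with the product of their common
  law, and nonnegativity together with integrability identifies the Bochner integral with the
  nonnegative one.\<close>

lemma integral_lambda_min_eq:
  fixes X :: "'a \<Rightarrow> real Matrix.vec" and Y :: "nat \<Rightarrow> 'b \<Rightarrow> real Matrix.vec"
  assumes N: "prob_space N" and M: "prob_space M" and X: "random_vector M n X"
    and cov: "has_mat_expectation M (\<lambda>\<omega>. outer_prod (X \<omega>) (X \<omega>)) (1\<^sub>m n)"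
    and Y: "iid_copies N {1..m} Y n M X" and n: "n \<ge> 1" and m: "m \<ge> 1"
  defines "I \<equiv> \<integral>\<omega>. lambda_min (sum_outer_prod n m (\<lambda>k. Y k \<omega>)) \<partial>N"
  shows "0 \<le> I"
    and "ennreal I = (\<integral>\<^sup>+\<omega>. ennreal (eigval n (\<lambda>i j. \<Sum>l\<in>{1..m}. \<omega> l $ i * \<omega> l $ j) 0)
      \<partial>(\<Pi>\<^sub>M l\<in>{1..m}. distr M (borel_vec n) X))"
proof -
  interpret N: prob_space N by (rule N)
  define D where "D = distr M (borel_vec n) X"
  interpret iso: isotropic_vector D n "($)"
    unfolding D_def by (rule isotropic_vector_distr[OF M X cov])
  have ind: "N.indep_vars (\<lambda>_. borel_vec n) Y {1..m}"
    and D: "\<And>l. l \<in> {1..m} \<Longrightarrow> distr N (borel_vec n) (Y l) = D"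
    using Y by (auto simp: iid_copies_def D_def)
  have rv: "Y l \<in> measurable N (borel_vec n)" if "l \<in> {1..m}" for l
    using ind that by (simp add: N.indep_vars_def)
  define G where "G = (\<lambda>x :: nat \<Rightarrow> real Matrix.vec. eigval n (\<lambda>i j. \<Sum>l\<in>{1..m}. x l $ i * x l $ j) 0)"
  have sym: "symm n (\<lambda>i j. \<Sum>l\<in>{1..m}. x l $ i * x l $ j)" for x :: "nat \<Rightarrow> real Matrix.vec"
    by (simp add: symm_def mult.commute)
  have G0: "0 \<le> G x" for x
    unfolding G_def by (rule eigval_0_gram_nonneg[OF n])
  have G_le: "G x \<le> (\<Sum>l\<in>{1..m}. (x l $ 0)\<^sup>2)" for x
    unfolding G_def using eigval_0_le_diagonal[OF sym n, of x] by (simp add: power2_eq_square)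
  have G_meas: "G \<in> borel_measurable (\<Pi>\<^sub>M l\<in>{1..m}. borel_vec n)"
    unfolding G_def
  proof (rule eigval_0_measurable[OF n sym])
    fix i j assume ij: "i < n" "j < n"
    have "(\<lambda>x. x l $ i) \<in> borel_measurable (\<Pi>\<^sub>M l\<in>{1..m}. borel_vec n)" if "l \<in> {1..m}" "i < n" for l i
      using measurable_compose[OF measurable_component_singleton[OF that(1)] vec_index_measurable[OF that(2)]] .
    then show "(\<lambda>x. \<Sum>l\<in>{1..m}. x l $ i * x l $ j) \<in> borel_measurable (\<Pi>\<^sub>M l\<in>{1..m}. borel_vec n)"
      by (intro borel_measurable_sum borel_measurable_times) (use ij in auto)
  qed
  \<comment> \<open>The restriction to \<open>{1..m}\<close> is needed because the product measure
    lives on extensional functions.\<close>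
  define Z where "Z = (\<lambda>\<omega>. \<lambda>l\<in>{1..m}. Y l \<omega>)"
  have Z: "Z \<in> measurable N (\<Pi>\<^sub>M l\<in>{1..m}. borel_vec n)"
    unfolding Z_def by (intro measurable_restrict rv)
  have GZ: "lambda_min (sum_outer_prod n m (\<lambda>k. Y k \<omega>)) = G (Z \<omega>)" if "\<omega> \<in> space N" for \<omega>
  proof -
    have "lambda_min (sum_outer_prod n m (\<lambda>k. Y k \<omega>)) = G (\<lambda>k. Y k \<omega>)"
      unfolding G_def using measurable_space[OF rv that] by (intro lambda_min_sum_outer_prod[OF n]) auto
    also have "\<dots> = G (Z \<omega>)" by (simp add: G_def Z_def)
    finally show ?thesis .
  qed
  \<comment> \<open>Without integrability the Bochner integral would take its default value 0 and
    not represent the expectation.\<close>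
  have int: "integrable N (\<lambda>\<omega>. G (Z \<omega>))"
  proof (rule Bochner_Integration.integrable_bound)
    have "integrable N (\<lambda>\<omega>. (Y l \<omega> $ 0)\<^sup>2)" if "l \<in> {1..m}" for l
    proof -
      have "integrable D (\<lambda>v. v $ 0 * v $ 0)"
        using iso.cov[of 0 0] n by (simp add: has_bochner_integral_iff)
      then have "integrable (distr N (borel_vec n) (Y l)) (\<lambda>v. v $ 0 * v $ 0)"
        by (simp add: D[OF that])
      then show ?thesis
        using n rv[OF that] by (subst (asm) integrable_distr_eq) (simp_all add: power2_eq_square)
    qed
    then show "integrable N (\<lambda>\<omega>. \<Sum>l\<in>{1..m}. (Y l \<omega> $ 0)\<^sup>2)" by (rule Bochner_Integration.integrable_sum)
    show "(\<lambda>\<omega>. G (Z \<omega>)) \<in> borel_measurable N" by (rule measurable_compose[OF Z G_meas])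
    have "norm (G (Z \<omega>)) \<le> norm (\<Sum>l\<in>{1..m}. (Y l \<omega> $ 0)\<^sup>2)" for \<omega>
    proof -
      have "norm (G (Z \<omega>)) = G (Z \<omega>)" using G0 by simp
      also have "\<dots> \<le> (\<Sum>l\<in>{1..m}. (Z \<omega> l $ 0)\<^sup>2)" by (rule G_le)
      also have "\<dots> = (\<Sum>l\<in>{1..m}. (Y l \<omega> $ 0)\<^sup>2)" by (simp add: Z_def)
      also have "\<dots> \<le> norm (\<Sum>l\<in>{1..m}. (Y l \<omega> $ 0)\<^sup>2)" by simp
      finally show ?thesis .
    qed
    then show "AE \<omega> in N. norm (G (Z \<omega>)) \<le> norm (\<Sum>l\<in>{1..m}. (Y l \<omega> $ 0)\<^sup>2)" by simp
  qed
  have I: "I = (\<integral>\<omega>. G (Z \<omega>) \<partial>N)"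
    unfolding I_def by (intro Bochner_Integration.integral_cong GZ refl)
  show "0 \<le> I" unfolding I using G0 by (intro integral_nonneg_AE) simp
  have "ennreal I = (\<integral>\<^sup>+\<omega>. ennreal (G (Z \<omega>)) \<partial>N)"
    unfolding I using int G0 by (intro nn_integral_eq_integral[symmetric]) auto
  also have "\<dots> = (\<integral>\<^sup>+x. ennreal (G x) \<partial>distr N (\<Pi>\<^sub>M l\<in>{1..m}. borel_vec n) Z)"
    using Z G_meas by (intro nn_integral_distr[symmetric]) auto
  also have "distr N (\<Pi>\<^sub>M l\<in>{1..m}. borel_vec n) Z = (\<Pi>\<^sub>M l\<in>{1..m}. distr N (borel_vec n) (Y l))"
    using N.indep_vars_iff_distr_eq_PiM'[where I = "{1..m}" and M' = "\<lambda>_. borel_vec n" and X = Y] ind m rv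
    unfolding Z_def by simp
  also have "\<dots> = (\<Pi>\<^sub>M l\<in>{1..m}. D)"
    by (intro PiM_cong refl D)
  finally show "ennreal I = (\<integral>\<^sup>+\<omega>. ennreal (eigval n (\<lambda>i j. \<Sum>l\<in>{1..m}. \<omega> l $ i * \<omega> l $ j) 0)
      \<partial>(\<Pi>\<^sub>M l\<in>{1..m}. distr M (borel_vec n) X))"
    by (simp add: G_def D_def)
qed

text \<open>The value \<phi> = s / (1 - s) maximises m / (1 + \<phi>) - n / \<phi>, and the maximum
  is m (1 - s)^2 = (\<surd>m - \<surd>n)^2. The factor lost to \<epsilon> and the constant cost K
  \<phi> may each consume a share \<theta> / 2 of it.\<close>

lemma edge_value_ge:
  fixes m n K \<theta> \<sigma> \<epsilon> :: real
  assumes n: "0 < n" and ratio: "n < \<sigma>\<^sup>2 * m" and m: "0 < m" and \<sigma>: "0 < \<sigma>" "\<sigma> < 1" and \<theta>: "0 < \<theta>" "\<theta> \<le> 1"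
    and K: "0 \<le> K" and \<epsilon>: "\<epsilon> = \<theta> * (1 - \<sigma>) / 6" and big: "2 * K \<le> \<theta> * (1 - \<sigma>) ^ 3 * n"
  defines "s \<equiv> sqrt n / sqrt m"
  defines "\<phi> \<equiv> s / (1 - s)"
  shows "(1 - \<theta>) * (sqrt m - sqrt n)\<^sup>2 \<le>
    (1 - \<epsilon>) / (1 + \<epsilon>)\<^sup>2 * m / (1 + \<phi>) - n / \<phi> - K * \<phi>"
    and "0 < \<phi>" and "0 < (sqrt m - sqrt n)\<^sup>2"
proof -
  have s0: "0 < s" using n m by (simp add: s_def)
  have "sqrt n < sqrt (\<sigma>\<^sup>2 * m)" using ratio by simp
  then have "sqrt n < \<sigma> * sqrt m" using \<sigma> by (simp add: real_sqrt_mult)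
  then have s\<sigma>: "s < \<sigma>" using m by (simp add: s_def pos_divide_less_eq)
  then have s1: "s < 1" using \<sigma> by simp
  show \<phi>0: "0 < \<phi>" using s0 s1 by (simp add: \<phi>_def)
  have ns: "n = m * s\<^sup>2" using n m by (simp add: s_def power_divide)
  have "sqrt n = sqrt m * s" using m by (simp add: s_def)
  then have "sqrt m - sqrt n = sqrt m * (1 - s)" by (simp add: right_diff_distrib)
  then have sq: "(sqrt m - sqrt n)\<^sup>2 = m * (1 - s)\<^sup>2"
    using m by (simp add: power_mult_distrib)
  then show "0 < (sqrt m - sqrt n)\<^sup>2" using m s1 by simp
  define \<kappa> where "\<kappa> = (1 - \<epsilon>) / (1 + \<epsilon>)\<^sup>2"
  have e0: "0 < \<epsilon>" using \<theta> \<sigma> by (simp add: \<epsilon>)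
  \<comment> \<open>Linear lower bound 1 - 3 \<epsilon> for the factor in front of m.\<close>
  have "(1 - 3 * \<epsilon>) * (1 + \<epsilon>)\<^sup>2 = 1 - \<epsilon> - 5 * \<epsilon>\<^sup>2 - 3 * \<epsilon> ^ 3"
    by (simp add: power2_eq_square power3_eq_cube algebra_simps)
  also have "\<dots> \<le> 1 - \<epsilon>" using zero_le_power2[of \<epsilon>] zero_le_power[OF less_imp_le[OF e0], of 3] by linarith
  finally have \<kappa>: "1 - 3 * \<epsilon> \<le> \<kappa>"
    using e0 by (simp add: \<kappa>_def pos_le_divide_eq)
  have "1 + \<phi> = 1 / (1 - s)" using s1 by (simp add: \<phi>_def field_simps)
  then have "\<kappa> * m / (1 + \<phi>) = \<kappa> * (m * (1 - s))" by simp
  also have "\<dots> \<ge> (1 - 3 * \<epsilon>) * (m * (1 - s))" using \<kappa> m s1 by (intro mult_right_mono) auto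
  finally have 1: "(1 - 3 * \<epsilon>) * (m * (1 - s)) \<le> \<kappa> * m / (1 + \<phi>)" .
  have 2: "n / \<phi> = m * s * (1 - s)"
    using s0 s1 by (simp add: \<phi>_def ns power2_eq_square)
  \<comment> \<open>By the choice of \<epsilon>, 3 \<epsilon> = \<theta> (1 - \<sigma>) / 2, and s <
    \<sigma> supplies the second factor 1 - s of the main term.\<close>
  have "3 * \<epsilon> * (m * (1 - s)) \<le> \<theta> * (1 - s) / 2 * (m * (1 - s))"
    using s\<sigma> s1 m \<theta> by (intro mult_right_mono) (auto simp: \<epsilon>)
  also have "\<dots> = \<theta> / 2 * (m * (1 - s)\<^sup>2)" by (simp add: power2_eq_square)
  finally have 3: "3 * \<epsilon> * (m * (1 - s)) \<le> \<theta> / 2 * (m * (1 - s)\<^sup>2)" .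
  \<comment> \<open>The ratio stays away from 1, so \<phi> is bounded independently of n, and a
    large n outweighs K.\<close>
  have "s / (1 - s) \<le> 1 / (1 - \<sigma>)" using s0 s1 s\<sigma> \<sigma> by (intro frac_le) auto
  then have "K * \<phi> \<le> K / (1 - \<sigma>)" using K mult_left_mono[of _ _ K] by (fastforce simp: \<phi>_def)
  also have "\<dots> \<le> \<theta> / 2 * (n * (1 - \<sigma>)\<^sup>2)"
    using big \<sigma> by (simp add: field_simps power2_eq_square power3_eq_cube)
  also have "\<dots> \<le> \<theta> / 2 * (m * (1 - s)\<^sup>2)"
  proof -
    have "s\<^sup>2 \<le> 1" using s0 s1 by (simp add: power_le_one)
    then have "n \<le> m" unfolding ns using m by (simp add: mult_left_le)
    moreover have "(1 - \<sigma>)\<^sup>2 \<le> (1 - s)\<^sup>2" using s\<sigma> \<sigma> by (intro power_mono) auto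
    ultimately show ?thesis using \<theta> m by (intro mult_left_mono mult_mono) auto
  qed
  finally have 4: "K * \<phi> \<le> \<theta> / 2 * (m * (1 - s)\<^sup>2)" .
  have "m * (1 - s)\<^sup>2 = m * (1 - s) - m * s * (1 - s)" by (simp add: power2_eq_square algebra_simps)
  then show "(1 - \<theta>) * (sqrt m - sqrt n)\<^sup>2 \<le>
    (1 - \<epsilon>) / (1 + \<epsilon>)\<^sup>2 * m / (1 + \<phi>) - n / \<phi> - K * \<phi>"
    using 1 2 3 4 unfolding sq \<kappa>_def[symmetric] by (simp add: left_diff_distrib)
qed

section \<open>From the barrier bound to the limit inferior\<close>

theorem theorem1p5:
  fixes M :: "nat \<Rightarrow> 'a measure" and N :: "nat \<Rightarrow> 'b measure"
    and X :: "nat \<Rightarrow> 'a \<Rightarrow> real Matrix.vec"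
    and Y :: "nat \<Rightarrow> nat \<Rightarrow> 'b \<Rightarrow> real Matrix.vec"
    and m :: "nat \<Rightarrow> nat" and \<rho> :: ereal
  assumes prob_M: "\<And>n. n \<ge> 1 \<Longrightarrow> prob_space (M n)"
    and X: "\<And>n. n \<ge> 1 \<Longrightarrow> random_vector (M n) n (X n)"
    and mean: "\<And>n. n \<ge> 1 \<Longrightarrow> has_vec_expectation (M n) (X n) (0\<^sub>v n)"
    and cov: "\<And>n. n \<ge> 1 \<Longrightarrow>
      has_mat_expectation (M n) (\<lambda>\<omega>. outer_prod (X n \<omega>) (X n \<omega>)) (1\<^sub>m n)"
    and m_pos: "\<And>n. n \<ge> 1 \<Longrightarrow> m n \<ge> 1"
    and ratio_liminf: "0 < liminf (\<lambda>n. ereal (real n / real (m n)))"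
    and ratio_limsup: "\<rho> = limsup (\<lambda>n. ereal (real n / real (m n)))"
    and rho_finite: "\<rho> < \<infinity>"
    and prob_N: "\<And>n. n \<ge> 1 \<Longrightarrow> prob_space (N n)"
    and Y: "\<And>n. n \<ge> 1 \<Longrightarrow> iid_copies (N n) {1..m n} (Y n) n (M n) (X n)"
    and rho_less: "\<rho> < 1"
    and cond_a: "((\<lambda>K::real. SUP n\<in>{1..}. SUP y\<in>unit_sphere n.
        ereal (\<integral>\<omega>. (X n \<omega> \<bullet> y)\<^sup>2 * indicator {\<omega>. (X n \<omega> \<bullet> y)\<^sup>2 \<ge> K} \<omega> \<partial>(M n)))
        \<longlongrightarrow> 0) at_top"
    and cond_b: "\<exists>f g :: nat \<Rightarrow> real.
        (\<forall>r\<ge>1. 0 \<le> f r \<and> f r \<le> 1) \<and> (\<forall>r\<ge>1. 0 \<le> g r) \<and>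
        f \<longlonglongrightarrow> 0 \<and> g \<longlonglongrightarrow> 0 \<and>
        (\<forall>n\<ge>1. \<forall>P. orthogonal_projection n P \<and> P \<noteq> 0\<^sub>m n n \<longrightarrow>
          measure (M n) {\<omega> \<in> space (M n).
              (euclid_norm (P *\<^sub>v X n \<omega>))\<^sup>2 - real (vec_space.rank n P)
                \<ge> f (vec_space.rank n P) * real (vec_space.rank n P)}
            \<le> g (vec_space.rank n P))"
  shows "1 \<le> liminf (\<lambda>n. ereal
    ((\<integral>\<omega>. lambda_min (sum_outer_prod n (m n) (\<lambda>k. Y n k \<omega>)) \<partial>(N n))
      / (sqrt (real (m n)) - sqrt (real n))\<^sup>2))"
proof -
  obtain f g :: "nat \<Rightarrow> real" where f0: "\<And>r. r \<ge> 1 \<Longrightarrow> 0 \<le> f r" and f: "f \<longlonglongrightarrow> 0" and g: "g \<longlonglongrightarrow> 0"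
    and conc: "\<And>n P. n \<ge> 1 \<Longrightarrow> orthogonal_projection n P \<Longrightarrow> P \<noteq> 0\<^sub>m n n \<Longrightarrow>
      measure (M n) {\<omega> \<in> space (M n). (euclid_norm (P *\<^sub>v X n \<omega>))\<^sup>2 - real (vec_space.rank n P)
        \<ge> f (vec_space.rank n P) * real (vec_space.rank n P)} \<le> g (vec_space.rank n P)"
    using cond_b by blast
  define D where "D = (\<lambda>n. distr (M n) (borel_vec n) (X n))"
  have iso: "isotropic_vector (D n) n ($)" if "n \<ge> 1" for n
    unfolding D_def by (rule isotropic_vector_distr[OF prob_M[OF that] X[OF that] cov[OF that]])
  have carr: "X n \<omega> \<in> carrier_vec n" if "n \<ge> 1" "\<omega> \<in> space (M n)" for n \<omega>
    using measurable_space[OF X[OF that(1)] that(2)] by simp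
  have sets_D: "sets (D n) = sets (borel_vec n)" for n by (simp add: D_def)
  have trunc: "\<exists>K\<ge>0. \<forall>n\<ge>1. \<forall>y. ip n y y = 1 \<longrightarrow>
      (\<integral>v. (ip n (($) v) y)\<^sup>2 * indicator {v. K \<le> (ip n (($) v) y)\<^sup>2} v \<partial>D n) \<le> c" if c: "0 < c" for c
  proof -
    have "eventually (\<lambda>K::real. (SUP n\<in>{1..}. SUP y\<in>unit_sphere n.
        ereal (\<integral>\<omega>. (X n \<omega> \<bullet> y)\<^sup>2 * indicator {\<omega>. (X n \<omega> \<bullet> y)\<^sup>2 \<ge> K} \<omega> \<partial>(M n))) < ereal c \<and> 0 \<le> K) at_top"
      using order_tendstoD(2)[OF cond_a, of "ereal c"] c by (intro eventually_conj eventually_ge_at_top) simp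
    then obtain K :: real where K: "(SUP n\<in>{1..}. SUP y\<in>unit_sphere n.
        ereal (\<integral>\<omega>. (X n \<omega> \<bullet> y)\<^sup>2 * indicator {\<omega>. (X n \<omega> \<bullet> y)\<^sup>2 \<ge> K} \<omega> \<partial>(M n))) < ereal c" "0 \<le> K"
      by (auto simp: eventually_at_top_linorder)
    have "(\<integral>v. (ip n (($) v) y)\<^sup>2 * indicator {v. K \<le> (ip n (($) v) y)\<^sup>2} v \<partial>D n) \<le> c"
      if n: "n \<ge> 1" and y: "ip n y y = 1" for n y
    proof -
      define z where "z = Matrix.vec n y"
      have z: "z \<in> carrier_vec n" by (simp add: z_def)
      have ipz: "x \<bullet> z = ip n (($) x) y" for x
        unfolding scalar_prod_ip[OF z] by (rule ip_cong) (simp_all add: z_def)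
      have "ip n (($) z) y = ip n y y" by (rule ip_cong) (simp_all add: z_def)
      then have "z \<in> unit_sphere n"
        using y z by (simp add: unit_sphere_def euclid_norm_def ipz)
      then have "ereal (\<integral>\<omega>. (X n \<omega> \<bullet> z)\<^sup>2 * indicator {\<omega>. (X n \<omega> \<bullet> z)\<^sup>2 \<ge> K} \<omega> \<partial>(M n))
          \<le> (SUP y\<in>unit_sphere n. ereal (\<integral>\<omega>. (X n \<omega> \<bullet> y)\<^sup>2 * indicator {\<omega>. (X n \<omega> \<bullet> y)\<^sup>2 \<ge> K} \<omega> \<partial>(M n)))"
        by (intro SUP_upper)
      also have "\<dots> \<le> (SUP n\<in>{1..}. SUP y\<in>unit_sphere n.
          ereal (\<integral>\<omega>. (X n \<omega> \<bullet> y)\<^sup>2 * indicator {\<omega>. (X n \<omega> \<bullet> y)\<^sup>2 \<ge> K} \<omega> \<partial>(M n)))"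
        using n by (intro SUP_upper2[of n]) auto
      also note K(1)
      finally have less: "(\<integral>\<omega>. (X n \<omega> \<bullet> z)\<^sup>2 * indicator {\<omega>. (X n \<omega> \<bullet> z)\<^sup>2 \<ge> K} \<omega> \<partial>(M n)) < c"
        by simp
      \<comment> \<open>The truncation event is a set of arbitrary vectors, not a subset of the
        carrier; \<open>h\<close> restates the integrand in a form whose measurability is
        immediate.\<close>
      define h where "h = (\<lambda>v. if K \<le> (ip n (($) v) y)\<^sup>2 then (ip n (($) v) y)\<^sup>2 else 0)"
      have [measurable]: "(\<lambda>v. ip n (($) v) y) \<in> borel_measurable (borel_vec n)"
        using isotropic_vector.ip_measurable[OF iso[OF n], of y] by (simp add: measurable_cong_sets[OF sets_D refl])
      have h: "h \<in> borel_measurable (borel_vec n)" unfolding h_def by measurable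
      have "(\<integral>v. (ip n (($) v) y)\<^sup>2 * indicator {v. K \<le> (ip n (($) v) y)\<^sup>2} v \<partial>D n) = (\<integral>v. h v \<partial>D n)"
        by (intro Bochner_Integration.integral_cong) (auto simp: h_def indicator_def)
      also have "\<dots> = (\<integral>\<omega>. h (X n \<omega>) \<partial>M n)"
        unfolding D_def by (rule integral_distr[OF X[OF n] h])
      also have "\<dots> = (\<integral>\<omega>. (X n \<omega> \<bullet> z)\<^sup>2 * indicator {\<omega>. (X n \<omega> \<bullet> z)\<^sup>2 \<ge> K} \<omega> \<partial>(M n))"
        by (intro Bochner_Integration.integral_cong) (auto simp: h_def ipz indicator_def)
      finally show ?thesis using less by simp
    qed
    then show ?thesis using K(2) by blast
  qed
  have proj: "measure (D n) {v \<in> space (D n). f r * real r \<le> (\<Sum>i<r. (ip n (($) v) (e i))\<^sup>2) - real r} \<le> g r"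
    if n: "n \<ge> 1" and r: "1 \<le> r" "r \<le> n" and e: "orthonormal n n e" for n e r
  proof -
    interpret isotropic_vector "D n" n "($)" by (rule iso[OF n])
    define P where "P = proj_mat n e {..<r}"
    have rank: "vec_space.rank n P = r" unfolding P_def by (rule rank_proj_mat[OF e r(2)])
    \<comment> \<open>A zero matrix would have rank 0, whereas r \<ge> 1.\<close>
    have "P \<noteq> 0\<^sub>m n n"
      using rank r(1) vec_space.rank_0I[where 'a = real, of n n] by auto
    then have le: "measure (M n) {\<omega> \<in> space (M n). f r * real r \<le> (euclid_norm (P *\<^sub>v X n \<omega>))\<^sup>2 - real r} \<le> g r"
      using conc[OF n _ , of P] orthogonal_projection_proj_mat[OF e r(2)] by (simp add: rank P_def[symmetric])
    define G where "G = {v \<in> space (D n). f r * real r \<le> (\<Sum>i<r. (ip n (($) v) (e i))\<^sup>2) - real r}"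
    have "G \<in> sets (D n)" unfolding G_def by measurable
    then have "measure (D n) G = measure (M n) (X n -` G \<inter> space (M n))"
      unfolding D_def by (intro measure_distr X[OF n]) simp
    also have "X n -` G \<inter> space (M n) = {\<omega> \<in> space (M n). f r * real r \<le> (euclid_norm (P *\<^sub>v X n \<omega>))\<^sup>2 - real r}"
      using carr[OF n] by (auto simp: G_def D_def P_def norm_proj_mat[OF e r(2)])
    finally show ?thesis using le by (simp add: G_def)
  qed
  show ?thesis
    unfolding le_Liminf_iff
  proof (intro allI impI)
    fix y :: ereal assume "y < 1"
    then obtain c where c: "y < ereal c" "ereal c < 1" using ereal_dense2 by blast
    \<comment> \<open>The maximum with 0 keeps \<theta> \<le> 1 even for negative c.\<close>
    define \<theta> where "\<theta> = 1 - max c 0"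
    have \<theta>: "0 < \<theta>" "\<theta> \<le> 1" using c(2) by (auto simp: \<theta>_def)
    have "ereal c \<le> ereal (1 - \<theta>)" by (simp add: \<theta>_def)
    with c(1) have y: "y < ereal (1 - \<theta>)" by (rule less_le_trans)
    obtain p where p: "\<rho> < ereal p" "ereal p < 1" using rho_less ereal_dense2 by blast
    \<comment> \<open>\<open>\<sigma>\<^sup>2\<close> lies strictly between the limit superior and
      1, and the maximum with 1 / 2 keeps \<sigma> positive.\<close>
    define \<sigma> where "\<sigma> = sqrt (max p (1 / 2))"
    have \<sigma>2: "\<sigma>\<^sup>2 = max p (1 / 2)" by (simp add: \<sigma>_def)
    have \<sigma>: "0 < \<sigma>" "\<sigma> < 1" using p(2) by (auto simp: \<sigma>_def)
    have "\<rho> < ereal (\<sigma>\<^sup>2)" using p(1) unfolding \<sigma>2 by (rule less_le_trans) simp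
    then have ratio: "eventually (\<lambda>n. ereal (real n / real (m n)) < ereal (\<sigma>\<^sup>2)) sequentially"
      unfolding ratio_limsup by (rule Limsup_lessD)
    define \<epsilon> where "\<epsilon> = \<theta> * (1 - \<sigma>) / 6"
    have "\<theta> * (1 - \<sigma>) \<le> 1 * 1" using \<theta> \<sigma> by (intro mult_mono) auto
    then have \<epsilon>: "0 < \<epsilon>" "\<epsilon> < 1" using \<theta> \<sigma> by (auto simp: \<epsilon>_def)
    obtain \<eta> R where \<eta>: "0 < \<eta>" and R: "0 \<le> R"
      and reg: "\<And>n. n \<ge> 1 \<Longrightarrow> regular_vector (D n) n ($) \<epsilon> \<eta> R (\<epsilon> * \<eta> / 2)"
      using regular_vectors[of D "\<lambda>_. ($)" f g \<epsilon>, OF iso trunc f0 f g proj \<epsilon>] by blast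
    \<comment> \<open>The two summands meet the two requirements on \<open>L\<close> separately.
      \<open>L\<close> and then \<open>K\<close> depend on \<epsilon>, \<eta> and \<open>R\<close>
      but not on n.\<close>
    define L where "L = 1 / \<epsilon> + 2 * R / (\<epsilon> * \<eta>)"
    have L: "1 \<le> \<epsilon> * L" "2 * R \<le> \<epsilon> * \<eta> * L"
      using \<epsilon> \<eta> R by (simp_all add: L_def distrib_left)
    define K where "K = (L + 1)\<^sup>2 / ((1 + \<epsilon>)\<^sup>2 * \<eta>)"
    have K: "0 \<le> K" using \<eta> by (simp add: K_def)
    have "eventually (\<lambda>n. 2 * K / (\<theta> * (1 - \<sigma>) ^ 3) \<le> real n) sequentially"
      using filterlim_real_sequentially by (simp add: filterlim_at_top)
    with ratio eventually_ge_at_top[of 1]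
    show "eventually (\<lambda>n. y < ereal
        ((\<integral>\<omega>. lambda_min (sum_outer_prod n (m n) (\<lambda>k. Y n k \<omega>)) \<partial>(N n))
          / (sqrt (real (m n)) - sqrt (real n))\<^sup>2)) sequentially"
    proof eventually_elim
      case (elim n)
      define I where "I = (\<integral>\<omega>. lambda_min (sum_outer_prod n (m n) (\<lambda>k. Y n k \<omega>)) \<partial>(N n))"
      have n: "n \<ge> 1" and m: "m n \<ge> 1" using elim(2) m_pos by auto
      note I = integral_lambda_min_eq[OF prob_N[OF n] prob_M[OF n] X[OF n] cov[OF n] Y[OF n] n m, folded I_def]
      interpret regular_vector "D n" n "($)" \<epsilon> \<eta> R "\<epsilon> * \<eta> / 2" by (rule reg[OF n])
      define s where "s = sqrt (real n) / sqrt (real (m n))"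
      define \<phi> where "\<phi> = s / (1 - s)"
      have "real n < \<sigma>\<^sup>2 * real (m n)"
        using elim(1) m by (simp add: pos_divide_less_eq)
      moreover have "2 * K \<le> \<theta> * (1 - \<sigma>) ^ 3 * real n"
        using elim(3) \<theta> \<sigma> by (simp add: pos_divide_le_eq mult.commute)
      ultimately have edge: "(1 - \<theta>) * (sqrt (real (m n)) - sqrt (real n))\<^sup>2 \<le>
          (1 - \<epsilon>) / (1 + \<epsilon>)\<^sup>2 * real (m n) / (1 + \<phi>) - real n / \<phi> - K * \<phi>"
        and \<phi>: "0 < \<phi>" and pos: "0 < (sqrt (real (m n)) - sqrt (real n))\<^sup>2"
        using edge_value_ge[of "real n" \<sigma> "real (m n)" \<theta> K \<epsilon>] n m \<sigma> \<theta> K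
        unfolding \<phi>_def s_def \<epsilon>_def by simp_all
      have "ennreal ((1 - \<epsilon>) / (1 + \<epsilon>)\<^sup>2 * real (m n) / (1 + \<phi>) - real n / \<phi> - K * \<phi>) \<le> ennreal I"
        using least_eigenvalue_lower_bound[OF \<phi> L, of "m n"] unfolding I(2) K_def D_def by simp
      \<comment> \<open>Returning to reals is sound because I \<ge> 0: a negative left side, cut off
        to 0 in \<open>ennreal\<close>, still satisfies the inequality.\<close>
      then have "(1 - \<epsilon>) / (1 + \<epsilon>)\<^sup>2 * real (m n) / (1 + \<phi>) - real n / \<phi> - K * \<phi> \<le> I"
        using I(1) by (simp add: ennreal_le_iff)
      with edge have "1 - \<theta> \<le> I / (sqrt (real (m n)) - sqrt (real n))\<^sup>2"
        using pos by (simp add: pos_le_divide_eq)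
      then have "ereal (1 - \<theta>) \<le> ereal (I / (sqrt (real (m n)) - sqrt (real n))\<^sup>2)" by simp
      with y show ?case unfolding I_def by (rule less_le_trans)
    qed
  qed
qed

end
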